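(* Let $p$ be a prime and let $G$ be a special $p$-group of order $p^n$ with $d(G)=d$ and $d(\gamma_2G)=k$, where $k>2$. If $d>k+1$, then \[|M(G)|\le p^{\frac{1}{2}(d-1)(n+k)-\left(\sum_{i=2}^{k+1}(d-i)\right)-(k-2)}.\]
   Context: A finite $p$-group $G$ is special if it is non-abelian and $Z(G)=\gamma_2G=\Phi(G)$ is elementary abelian (here $Z(G)$ is the center, $\gamma_2G$ the commutator subgroup and $\Phi(G)$ the Frattini subgroup). $d(H)$ denotes the minimal number of generators of $H$, and $M(G)$ is the Schur multiplier of $G$. *)

theory Defs
  imports "HOL-Algebra.Algebra" Complex_Main
begin

definition group_center :: "('a, 'b) monoid_scheme \<Rightarrow> 'a set" where
  "group_center G = {z \<in> carrier G. \<forall>x \<in> carrier G. z \<otimes>\<^bsub>G\<^esub> x = x \<otimes>\<^bsub>G\<^esub> z}"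

definition maximal_subgroup :: "'a set \<Rightarrow> ('a, 'b) monoid_scheme \<Rightarrow> bool" where
  "maximal_subgroup H G \<longleftrightarrow> subgroup H G \<and> H \<noteq> carrier G \<and>
     (\<forall>K. subgroup K G \<and> H \<subseteq> K \<longrightarrow> K = H \<or> K = carrier G)"

(* Frattini subgroup: intersection of all maximal subgroups (= G if there are none) *)
definition frattini :: "('a, 'b) monoid_scheme \<Rightarrow> 'a set" where
  "frattini G = carrier G \<inter> \<Inter>{H. maximal_subgroup H G}"

definition min_gens :: "('a, 'b) monoid_scheme \<Rightarrow> 'a set \<Rightarrow> nat" where
  "min_gens G H = (LEAST m. \<exists>S. S \<subseteq> H \<and> finite S \<and> card S = m \<and> generate G S = H)"

definition elementary_abelian :: "('a, 'b) monoid_scheme \<Rightarrow> 'a set \<Rightarrow> nat \<Rightarrow> bool" where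
  "elementary_abelian G H p \<longleftrightarrow>
     (\<forall>x \<in> H. \<forall>y \<in> H. x \<otimes>\<^bsub>G\<^esub> y = y \<otimes>\<^bsub>G\<^esub> x) \<and> (\<forall>x \<in> H. x [^]\<^bsub>G\<^esub> p = \<one>\<^bsub>G\<^esub>)"

definition special_p_group :: "('a, 'b) monoid_scheme \<Rightarrow> nat \<Rightarrow> bool" where
  "special_p_group G p \<longleftrightarrow> group G \<and> Factorial_Ring.prime p \<and> finite (carrier G) \<and>
     (\<exists>n. order G = p ^ n) \<and> \<not> comm_group G \<and>
     group_center G = derived G (carrier G) \<and>
     derived G (carrier G) = frattini G \<and>
     elementary_abelian G (group_center G) p"

(* Schur multiplier M(G) = H^2 of G with coefficients in nonzero complex numbers: normalised-on-carrier 2-cocycles G x G to nonzero complexes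
   modulo coboundaries *)
definition schur_cocycles :: "('a, 'b) monoid_scheme \<Rightarrow> ('a \<Rightarrow> 'a \<Rightarrow> complex) set" where
  "schur_cocycles G = {f.
     (\<forall>x \<in> carrier G. \<forall>y \<in> carrier G. f x y \<noteq> 0) \<and>
     (\<forall>x \<in> carrier G. \<forall>y \<in> carrier G. \<forall>z \<in> carrier G.
        f x y * f (x \<otimes>\<^bsub>G\<^esub> y) z = f y z * f x (y \<otimes>\<^bsub>G\<^esub> z)) \<and>
     (\<forall>x y. x \<notin> carrier G \<or> y \<notin> carrier G \<longrightarrow> f x y = 1)}"

definition cohomologous :: "('a, 'b) monoid_scheme \<Rightarrow> (('a \<Rightarrow> 'a \<Rightarrow> complex) \<times> ('a \<Rightarrow> 'a \<Rightarrow> complex)) set" where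
  "cohomologous G = {(f, f'). f \<in> schur_cocycles G \<and> f' \<in> schur_cocycles G \<and>
     (\<exists>g :: 'a \<Rightarrow> complex. (\<forall>x \<in> carrier G. g x \<noteq> 0) \<and>
        (\<forall>x \<in> carrier G. \<forall>y \<in> carrier G.
           f' x y = f x y * g x * g y / g (x \<otimes>\<^bsub>G\<^esub> y)))}"

definition schur_multiplier_order :: "('a, 'b) monoid_scheme \<Rightarrow> nat" where
  "schur_multiplier_order G = card (schur_cocycles G // cohomologous G)"

end

(* Write Z = Z(G) = G', so that |Z| = p^k and |G/Z| = p^d. A cocycle f gives the pairing
   theta(x,z) = f(x,z)/f(z,x) of G with Z; it is bimultiplicative and, by the Hall-Witt identity
   in the extension of G by C^* defined by f, satisfies the Jacobi identity
   theta(y,[x,w]) = theta(x,[y,w]) theta(w,[x,y]).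

   Counting the possible pairings. If theta(v,-) is trivial, then (x,y) |-> theta(x,[v,y]) is
   symmetric, so theta is trivial on [v,G] as soon as it is trivial on the r(r+1)/2 pairs
   (y_a,[v,y_b]), a <= b, where the [v,y_b] form a basis of [v,G], r = dim [v,G]. Iterating on
   G/[v,G] shows that theta is determined by j(j+3)/2 values if dim Z = j. If some v has
   2 <= r < k this already improves to k(k+1)/2 + 2 values. Otherwise some v has [v,G] = Z; as
   d > k + 1, there is v' centralising v outside <v>Z, and theta(x,[v',y]) is symmetric as well,
   which leaves k(k+1)/2 + 1 values.

   Counting the classes with a given pairing. It suffices to treat theta = 1. Then the preimage of
   Z in the extension is central and has a retraction onto C^*, which can be chosen trivial on the
   lifted commutators of k pairs of generators whose commutators form a basis of Z. Its values on
   the remaining d(d-1)/2 - k commutators of generators determine the class: if all of them are 1,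
   the retraction is trivial on commutators and so extends to the whole extension, because C^* is
   divisible. All values in question are p-th roots of unity. *)

theory Submission
  imports Defs
begin

section \<open>Adjoining elements to subgroups\<close>

text \<open>The iteration with r = 1 throughout costs k(k+3)/2 values. Added to d(d-1)/2 - k, the
  exponent of the theorem allows exactly k(k+1)/2 + 2, so the term k - 2 is the saving that one
  better first choice of \<open>v\<close> has to bring. A first \<open>v\<close> with 2 <= r < k
  beats the allowance by (k-r-1)(r-2) >= 0, while r = k costs k(k+3)/2 again; this is why the
  surjective case needs the second element \<open>v'\<close>. Some \<open>v\<close> with r >= 2
  exists because the commutator map is alternating: if every [v,G] were at most a line, so would be
  Z.

  Quotients such as G/[v,G] are never formed; a subgroup \<open>H\<close> of \<open>Z\<close> on
  which the pairing is trivial takes their place. Reduction to theta = 1 means division by a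
  reference cocycle chosen once for each table of pairing values. The final count is an injection of
  classes into pairs of tables of p-th roots of unity, evaluated at chosen representatives, so the
  choices made along the way need not be canonical.\<close>

definition commutator :: "('a, 'b) monoid_scheme \<Rightarrow> 'a \<Rightarrow> 'a \<Rightarrow> 'a" where
  "commutator G x y = x \<otimes>\<^bsub>G\<^esub> y \<otimes>\<^bsub>G\<^esub> inv\<^bsub>G\<^esub> x \<otimes>\<^bsub>G\<^esub> inv\<^bsub>G\<^esub> y"

text \<open>Natural exponents suffice once a positive power of \<open>w\<close> lies in
  \<open>B\<close>. The set is the subgroup generated by \<open>B\<close> and \<open>w\<close> when
  \<open>w\<close> also normalises \<open>B\<close>. The explicit form serves to count elements and
  to define characters by the exponent.\<close>

definition adjoin :: "('a, 'b) monoid_scheme \<Rightarrow> 'a set \<Rightarrow> 'a \<Rightarrow> 'a set" where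
  "adjoin G B w = {b \<otimes>\<^bsub>G\<^esub> w [^]\<^bsub>G\<^esub> i | b i. b \<in> B \<and> i \<in> (UNIV :: nat set)}"

text \<open>Modulo \<open>B\<close>, the elements of \<open>S\<close> commute and have exponent
  \<open>p\<close>. The condition survives adjoining any element of \<open>S\<close>, with the same
  \<open>S\<close>, which is what the inductions over lists need. It covers both subspaces of
  \<open>Z\<close> and steps from \<open>Z\<close> up to the whole group.\<close>

definition adjoinable :: "('a, 'b) monoid_scheme \<Rightarrow> nat \<Rightarrow> 'a set \<Rightarrow> 'a set \<Rightarrow> bool" where
  "adjoinable G p B S \<longleftrightarrow> subgroup B G \<and> S \<subseteq> carrier G \<and>
     (\<forall>w\<in>S. w [^]\<^bsub>G\<^esub> p \<in> B) \<and> (\<forall>w\<in>S. \<forall>x\<in>B \<union> S. commutator G w x \<in> B)"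

definition linear_char :: "('a, 'b) monoid_scheme \<Rightarrow> 'a set \<Rightarrow> ('a \<Rightarrow> complex) \<Rightarrow> bool" where
  "linear_char G B \<chi> \<longleftrightarrow> (\<forall>x\<in>B. \<chi> x \<noteq> 0) \<and> (\<forall>x\<in>B. \<forall>y\<in>B. \<chi> (x \<otimes>\<^bsub>G\<^esub> y) = \<chi> x * \<chi> y)"

text \<open>Linear independence over F_p modulo \<open>B\<close> in the adjoinable situation: an
  element outside the span so far enlarges it by the factor \<open>p\<close>.\<close>

fun independent_over :: "('a, 'b) monoid_scheme \<Rightarrow> 'a set \<Rightarrow> 'a list \<Rightarrow> bool" where
  "independent_over G B [] \<longleftrightarrow> True"
| "independent_over G B (w # ws) \<longleftrightarrow> w \<notin> B \<and> independent_over G (adjoin G B w) ws"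

lemma linear_charD:
  assumes "linear_char G B \<chi>"
  shows "x \<in> B \<Longrightarrow> \<chi> x \<noteq> 0" "x \<in> B \<Longrightarrow> y \<in> B \<Longrightarrow> \<chi> (x \<otimes>\<^bsub>G\<^esub> y) = \<chi> x * \<chi> y"
  using assms by (auto simp: linear_char_def)

context group
begin

lemma cancel_left [simp]:
  "x \<in> carrier G \<Longrightarrow> y \<in> carrier G \<Longrightarrow> inv x \<otimes> (x \<otimes> y) = y"
  "x \<in> carrier G \<Longrightarrow> y \<in> carrier G \<Longrightarrow> x \<otimes> (inv x \<otimes> y) = y"
  by (simp_all add: m_assoc [symmetric])

lemma commutator_closed [simp]:
  "x \<in> carrier G \<Longrightarrow> y \<in> carrier G \<Longrightarrow> commutator G x y \<in> carrier G"
  by (simp add: commutator_def)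

lemma commutator_swap:
  "x \<in> carrier G \<Longrightarrow> y \<in> carrier G \<Longrightarrow> x \<otimes> y = commutator G x y \<otimes> (y \<otimes> x)"
  by (simp add: commutator_def m_assoc)

lemma commutator_inv:
  "x \<in> carrier G \<Longrightarrow> y \<in> carrier G \<Longrightarrow> inv (commutator G x y) = commutator G y x"
  by (simp add: commutator_def m_assoc inv_mult_group)

lemma commutator_eq_one_iff:
  assumes "x \<in> carrier G" "y \<in> carrier G"
  shows "commutator G x y = \<one> \<longleftrightarrow> x \<otimes> y = y \<otimes> x"
proof
  assume "x \<otimes> y = y \<otimes> x"
  then show "commutator G x y = \<one>"
    using assms by (simp add: commutator_def m_assoc)
qed (use assms commutator_swap[of x y] in simp)

lemma commutator_self [simp]: "x \<in> carrier G \<Longrightarrow> commutator G x x = \<one>"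
  by (simp add: commutator_eq_one_iff)

lemma linear_char_one:
  assumes "linear_char G B \<chi>" "subgroup B G"
  shows "\<chi> \<one> = 1"
proof -
  have "\<one> \<in> B" using assms(2) by (rule subgroup.one_closed)
  then have "\<chi> (\<one> \<otimes> \<one>) = \<chi> \<one> * \<chi> \<one>" "\<chi> \<one> \<noteq> 0"
    using linear_charD[OF assms(1)] by blast+
  then show ?thesis by simp
qed

lemma linear_char_inv:
  assumes "linear_char G B \<chi>" "subgroup B G" "x \<in> B"
  shows "\<chi> (inv x) = inverse (\<chi> x)"
proof -
  have x: "inv x \<in> B" "x \<in> carrier G"
    using assms by (auto simp: subgroup.m_inv_closed subgroup.mem_carrier)
  then have "\<chi> (inv x) * \<chi> x = 1"
    using assms linear_charD(2)[OF assms(1) x(1) assms(3)] linear_char_one[OF assms(1,2)] by simp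
  then show ?thesis
    by (metis inverse_unique mult.commute)
qed

lemma linear_char_pow:
  assumes "linear_char G B \<chi>" "subgroup B G" "x \<in> B"
  shows "\<chi> (x [^] (n::nat)) = \<chi> x ^ n"
proof (induction n)
  case (Suc n)
  have "x [^] n \<in> B" using assms(2,3) by (induction n) (auto simp: subgroup.m_closed subgroup.one_closed)
  then show ?case using Suc assms linear_charD(2)[OF assms(1)] by simp
qed (use linear_char_one[OF assms(1,2)] in simp)

lemma subgroup_nat_pow_closed:
  "subgroup B G \<Longrightarrow> x \<in> B \<Longrightarrow> x [^] (n::nat) \<in> B"
  by (induction n) (auto simp: subgroup.m_closed subgroup.one_closed)

lemma adjoinableD:
  assumes "adjoinable G p B S"
  shows "subgroup B G" "S \<subseteq> carrier G" "w \<in> S \<Longrightarrow> w [^] p \<in> B"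
    "w \<in> S \<Longrightarrow> x \<in> B \<union> S \<Longrightarrow> commutator G w x \<in> B"
  using assms by (auto simp: adjoinable_def)

lemma adjoin_incl: "subgroup B G \<Longrightarrow> w \<in> carrier G \<Longrightarrow> B \<subseteq> adjoin G B w"
proof
  fix b assume "subgroup B G" "w \<in> carrier G" "b \<in> B"
  then have "b = b \<otimes> w [^] (0::nat)" by (simp add: subgroup.mem_carrier)
  then show "b \<in> adjoin G B w" using \<open>b \<in> B\<close> unfolding adjoin_def by blast
qed

lemma adjoin_mem: "subgroup B G \<Longrightarrow> w \<in> carrier G \<Longrightarrow> w \<in> adjoin G B w"
proof -
  assume "subgroup B G" "w \<in> carrier G"
  then have "w = \<one> \<otimes> w [^] (1::nat)" "\<one> \<in> B" by (simp_all add: subgroup.one_closed)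
  then show "w \<in> adjoin G B w" unfolding adjoin_def by blast
qed

lemma adjoin_least:
  assumes "subgroup M G" "B \<subseteq> M" "w \<in> M"
  shows "adjoin G B w \<subseteq> M"
  using assms subgroup_nat_pow_closed[OF assms(1,3)]
  unfolding adjoin_def by (auto intro!: subgroup.m_closed)

lemma conj_mult:
  "w \<in> carrier G \<Longrightarrow> x \<in> carrier G \<Longrightarrow> y \<in> carrier G \<Longrightarrow>
    w \<otimes> (x \<otimes> y) \<otimes> inv w = (w \<otimes> x \<otimes> inv w) \<otimes> (w \<otimes> y \<otimes> inv w)"
  by (simp add: m_assoc)

lemma conj_commutator:
  "w \<in> carrier G \<Longrightarrow> x \<in> carrier G \<Longrightarrow> w \<otimes> x \<otimes> inv w = commutator G w x \<otimes> x"
  by (simp add: commutator_def m_assoc)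

lemma adjoinable_conj:
  assumes "adjoinable G p B S" "w \<in> S" "b \<in> B"
  shows "w \<otimes> b \<otimes> inv w \<in> B"
proof -
  note D = adjoinableD[OF assms(1)]
  have "b \<in> carrier G" "w \<in> carrier G"
    using D(1,2) assms by (auto simp: subgroup.mem_carrier)
  then show ?thesis
    using conj_commutator[of w b] D(1) D(4)[OF assms(2)] assms(3) by (simp add: subgroup.m_closed)
qed

text \<open>The codomain of \<open>\<chi>\<close> is left arbitrary: with the constant map to the
  unit type only closure of \<open>B\<close> under conjugation remains, and with a complex character
  its invariance is included.\<close>

lemma conj_pow_invariant:
  assumes "subgroup B G" "w \<in> carrier G"
    and "\<And>b. b \<in> B \<Longrightarrow> w \<otimes> b \<otimes> inv w \<in> B \<and> \<chi> (w \<otimes> b \<otimes> inv w) = (\<chi> b :: 'c)"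
    and "b \<in> B"
  shows "w [^] (i::nat) \<otimes> b \<otimes> inv (w [^] i) \<in> B \<and> \<chi> (w [^] i \<otimes> b \<otimes> inv (w [^] i)) = \<chi> b"
proof (induction i)
  case 0
  then show ?case using assms by (simp add: subgroup.mem_carrier)
next
  case (Suc i)
  have "b \<in> carrier G" using assms by (simp add: subgroup.mem_carrier)
  then have "w [^] Suc i \<otimes> b \<otimes> inv (w [^] Suc i) = w \<otimes> (w [^] i \<otimes> b \<otimes> inv (w [^] i)) \<otimes> inv w"
    unfolding nat_pow_Suc2[OF assms(2)] using assms(2) by (simp add: inv_mult_group m_assoc)
  then show ?case using assms(3)[of "w [^] i \<otimes> b \<otimes> inv (w [^] i)"] Suc by simp
qed

text \<open>Otherwise Bezout gives m x = p y + 1, and \<open>w\<close> is a quotient of two powers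
  that lie in \<open>B\<close>.\<close>

lemma pow_mem_subgroup_imp_dvd:
  assumes "subgroup B G" "w \<in> carrier G" "w \<notin> B" "w [^] p \<in> B" "Factorial_Ring.prime p"
    "w [^] (m::nat) \<in> B"
  shows "p dvd m"
proof (rule ccontr)
  assume "\<not> p dvd m"
  then have "coprime m p" using assms(5) by (metis coprime_commute prime_imp_coprime)
  moreover have "m \<noteq> 0" using \<open>\<not> p dvd m\<close> by (cases m) auto
  ultimately obtain x y where xy: "m * x = p * y + 1"
    using bezout_nat[of m p] by auto
  have "w [^] (m * x) = w [^] (p * y) \<otimes> w"
    using xy assms(2) by simp
  moreover have "w [^] (m * x) \<in> B" "w [^] (p * y) \<in> B"
    using assms subgroup_nat_pow_closed[OF assms(1)] by (simp_all add: nat_pow_pow [symmetric])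
  ultimately have "inv (w [^] (p * y)) \<otimes> (w [^] (p * y) \<otimes> w) \<in> B"
    using assms(1) by (simp add: subgroup.m_inv_closed subgroup.m_closed)
  then show False using assms by simp
qed

lemma adjoin_mult:
  assumes "w \<in> carrier G" "b \<in> carrier G" "b' \<in> carrier G"
  shows "(b \<otimes> w [^] (i::nat)) \<otimes> (b' \<otimes> w [^] (j::nat)) =
    (b \<otimes> (w [^] i \<otimes> b' \<otimes> inv (w [^] i))) \<otimes> w [^] (i + j)"
  using assms by (simp add: m_assoc nat_pow_mult [symmetric])

lemma subgroup_adjoin:
  assumes "subgroup B G" "w \<in> carrier G" "w [^] p \<in> B" "p > (0::nat)"
    and "\<And>b. b \<in> B \<Longrightarrow> w \<otimes> b \<otimes> inv w \<in> B"
  shows "subgroup (adjoin G B w) G"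
proof (rule subgroupI)
  note conj = conj_pow_invariant[OF assms(1,2), of "\<lambda>_. ()", THEN conjunct1]
  show "adjoin G B w \<subseteq> carrier G"
    using assms by (auto simp: adjoin_def subgroup.mem_carrier)
  show "adjoin G B w \<noteq> {}"
    using adjoin_mem[OF assms(1,2)] by auto
  show "x \<otimes> y \<in> adjoin G B w" if xy: "x \<in> adjoin G B w" "y \<in> adjoin G B w" for x y
  proof -
    obtain b b' and i j :: nat where *: "b \<in> B" "b' \<in> B" "x = b \<otimes> w [^] i" "y = b' \<otimes> w [^] j"
      using xy unfolding adjoin_def by blast
    have "x \<otimes> y = (b \<otimes> (w [^] i \<otimes> b' \<otimes> inv (w [^] i))) \<otimes> w [^] (i + j)"
      unfolding * using assms * by (intro adjoin_mult) (auto simp: subgroup.mem_carrier)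
    moreover have "b \<otimes> (w [^] i \<otimes> b' \<otimes> inv (w [^] i)) \<in> B"
      using * conj[of b' i] assms by (auto intro: subgroup.m_closed)
    ultimately show ?thesis unfolding adjoin_def by blast
  qed
  show "inv x \<in> adjoin G B w" if x: "x \<in> adjoin G B w" for x
  proof -
    obtain b and i :: nat where *: "b \<in> B" "x = b \<otimes> w [^] i"
      using x unfolding adjoin_def by blast
    \<comment> \<open>A natural exponent that replaces -i: since i + j = p i, the inverse of
      \<open>w [^] i\<close> is \<open>w [^] j\<close> times the inverse of
      \<open>w [^] (p * i)\<close>, and the latter belongs to \<open>B\<close>.\<close>
    define j where "j = i * (p - 1)"
    have ij: "i + j = p * i" using assms(4) by (cases p) (simp_all add: j_def algebra_simps)
    have b: "inv b \<in> B" "b \<in> carrier G"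
      using * assms by (auto simp: subgroup.m_inv_closed subgroup.mem_carrier)
    have "w [^] (p * i) = w [^] j \<otimes> w [^] i"
      using ij assms(2) by (simp add: nat_pow_mult add.commute)
    then have "inv (w [^] (p * i)) \<otimes> w [^] j = inv (w [^] i)"
      using assms(2) by (simp add: inv_mult_group m_assoc)
    then have "inv x = (inv (w [^] (p * i)) \<otimes> w [^] j) \<otimes> inv b"
      using * b assms(2) by (simp add: inv_mult_group)
    also have "\<dots> = (inv (w [^] (p * i)) \<otimes> (w [^] j \<otimes> inv b \<otimes> inv (w [^] j))) \<otimes> w [^] j"
      using b assms(2) by (simp add: m_assoc)
    finally have "inv x = (inv (w [^] (p * i)) \<otimes> (w [^] j \<otimes> inv b \<otimes> inv (w [^] j))) \<otimes> w [^] j" .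
    moreover have "inv (w [^] (p * i)) \<otimes> (w [^] j \<otimes> inv b \<otimes> inv (w [^] j)) \<in> B"
      using conj[of "inv b" j] b assms subgroup_nat_pow_closed[OF assms(1,3), of i]
      by (auto intro!: subgroup.m_closed subgroup.m_inv_closed simp: nat_pow_pow)
    ultimately show ?thesis unfolding adjoin_def by blast
  qed
qed

lemma adjoin_eq_iff:
  assumes "subgroup B G" "w \<in> carrier G" "b \<in> B" "b' \<in> B" "i \<le> j"
    and eq: "b \<otimes> w [^] (i::nat) = b' \<otimes> w [^] (j::nat)"
  shows "w [^] (j - i) \<in> B" "b = b' \<otimes> w [^] (j - i)"
proof -
  have bb: "b \<in> carrier G" "b' \<in> carrier G" using assms by (auto simp: subgroup.mem_carrier)
  have "w [^] j = w [^] (j - i) \<otimes> w [^] i" using assms by (simp add: nat_pow_mult)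
  then have "b \<otimes> w [^] i = (b' \<otimes> w [^] (j - i)) \<otimes> w [^] i"
    using eq bb assms(2) by (simp add: m_assoc)
  then show *: "b = b' \<otimes> w [^] (j - i)" using bb assms(2) by (meson m_closed nat_pow_closed r_cancel)
  then have "inv b' \<otimes> b = w [^] (j - i)" using bb assms(2) by simp
  then show "w [^] (j - i) \<in> B"
    using assms by (metis subgroup.m_closed subgroup.m_inv_closed)
qed

text \<open>Exponents reduce modulo \<open>p\<close>, as \<open>w [^] p\<close> is absorbed into
  \<open>B\<close>. For \<open>w \<notin> B\<close> the \<open>p\<close> reduced exponents belong to
  different cosets of \<open>B\<close>.\<close>

lemma card_adjoin:
  assumes "subgroup B G" "w \<in> carrier G" "w [^] p \<in> B" "Factorial_Ring.prime p" "finite B"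
  shows "finite (adjoin G B w)" "card (adjoin G B w) \<le> p * card B"
    "w \<notin> B \<Longrightarrow> card (adjoin G B w) = p * card B"
proof -
  let ?h = "\<lambda>(b, i::nat). b \<otimes> w [^] i"
  have p: "p > 0" using assms(4) by (rule prime_gt_0_nat)
  have img: "adjoin G B w = ?h ` (B \<times> {..<p})"
  proof (intro equalityI subsetI)
    fix x assume "x \<in> adjoin G B w"
    then obtain b and i :: nat where *: "b \<in> B" "x = b \<otimes> w [^] i"
      unfolding adjoin_def by blast
    have "w [^] i = (w [^] p) [^] (i div p) \<otimes> w [^] (i mod p)"
      using assms(2) by (simp add: nat_pow_pow nat_pow_mult)
    then have "x = (b \<otimes> (w [^] p) [^] (i div p)) \<otimes> w [^] (i mod p)"
      using * assms by (simp add: m_assoc subgroup.mem_carrier)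
    moreover have "b \<otimes> (w [^] p) [^] (i div p) \<in> B"
      using * assms subgroup_nat_pow_closed by (simp add: subgroup.m_closed)
    ultimately show "x \<in> ?h ` (B \<times> {..<p})"
      using p by (intro image_eqI[of _ _ "(b \<otimes> (w [^] p) [^] (i div p), i mod p)"]) auto
  qed (auto simp: adjoin_def)
  then show "finite (adjoin G B w)" using assms(5) by simp
  show "card (adjoin G B w) \<le> p * card B"
    using card_image_le[of "B \<times> {..<p}" ?h] assms(5) by (simp add: img card_cartesian_product mult.commute)
  assume w: "w \<notin> B"
  have key: "b = b' \<and> i = j" if "b \<in> B" "b' \<in> B" "i \<le> j" "j < p" "b \<otimes> w [^] i = b' \<otimes> w [^] j"
    for b b' and i j :: nat
  proof -
    have "p dvd j - i"
      using pow_mem_subgroup_imp_dvd[OF assms(1,2) w assms(3,4)]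
        adjoin_eq_iff(1)[OF assms(1,2) that(1-3,5)] by blast
    then have "j = i" using that by (auto dest: dvd_imp_le)
    moreover have "b = b'" using adjoin_eq_iff(2)[OF assms(1,2) that(1-3,5)] \<open>j = i\<close> that assms(1)
      by (simp add: subgroup.mem_carrier)
    ultimately show ?thesis by simp
  qed
  have "inj_on ?h (B \<times> {..<p})"
  proof (rule inj_onI, clarsimp)
    fix b b' and i j :: nat
    assume "b \<in> B" "b' \<in> B" "i < p" "j < p" "b \<otimes> w [^] i = b' \<otimes> w [^] j"
    then show "b = b' \<and> i = j" using key[of b b' i j] key[of b' b j i] by (cases "i \<le> j") auto
  qed
  then show "card (adjoin G B w) = p * card B"
    by (simp add: img card_image card_cartesian_product mult.commute)
qed

text \<open>Two representations of an element differ by a power of \<open>w [^] p\<close>, on which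
  \<open>\<chi>\<close> and \<open>\<zeta>\<close> agree; so every p-th root \<open>\<zeta>\<close>
  of the forced value is an admissible value at \<open>w\<close>. Invariance under conjugation by
  \<open>w\<close> makes the extension multiplicative.\<close>

lemma linear_char_adjoin:
  assumes B: "subgroup B G" and w: "w \<in> carrier G" "w [^] p \<in> B" "w \<notin> B"
    and p: "Factorial_Ring.prime p" and \<chi>: "linear_char G B \<chi>"
    and conj: "\<And>b. b \<in> B \<Longrightarrow> w \<otimes> b \<otimes> inv w \<in> B \<and> \<chi> (w \<otimes> b \<otimes> inv w) = \<chi> b"
    and \<zeta>: "\<zeta> ^ p = \<chi> (w [^] p)"
  obtains \<chi>' where "linear_char G (adjoin G B w) \<chi>'"
    "\<And>b i. b \<in> B \<Longrightarrow> \<chi>' (b \<otimes> w [^] (i::nat)) = \<chi> b * \<zeta> ^ i"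
    "\<And>b. b \<in> B \<Longrightarrow> \<chi>' b = \<chi> b" "\<chi>' w = \<zeta>"
proof -
  define \<chi>' where "\<chi>' x = (THE c. \<exists>b (i::nat). b \<in> B \<and> x = b \<otimes> w [^] i \<and> c = \<chi> b * \<zeta> ^ i)" for x
  have key: "\<chi> b * \<zeta> ^ i = \<chi> b' * \<zeta> ^ j"
    if "b \<in> B" "b' \<in> B" "i \<le> j" "b \<otimes> w [^] i = b' \<otimes> w [^] j" for b b' and i j :: nat
  proof -
    have "p dvd j - i"
      using pow_mem_subgroup_imp_dvd[OF B w(1,3,2) p] adjoin_eq_iff(1)[OF B w(1) that] by blast
    then obtain q where q: "j - i = p * q" by blast
    have "b = b' \<otimes> (w [^] p) [^] q"
      using adjoin_eq_iff(2)[OF B w(1) that] w(1) by (simp add: q nat_pow_pow)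
    then have "\<chi> b = \<chi> b' * \<zeta> ^ (j - i)"
      using linear_charD(2)[OF \<chi> that(2), of "(w [^] p) [^] q"] subgroup_nat_pow_closed[OF B w(2)]
        linear_char_pow[OF \<chi> B w(2)] by (simp add: \<zeta> [symmetric] power_mult [symmetric] q)
    then show ?thesis using that(3) by (simp add: power_add [symmetric])
  qed
  have eval: "\<chi>' (b \<otimes> w [^] i) = \<chi> b * \<zeta> ^ i" if "b \<in> B" for b and i :: nat
    unfolding \<chi>'_def
  proof (rule the_equality)
    fix c assume "\<exists>b' (i'::nat). b' \<in> B \<and> b \<otimes> w [^] i = b' \<otimes> w [^] i' \<and> c = \<chi> b' * \<zeta> ^ i'"
    then obtain b' and i' :: nat where *: "b' \<in> B" "b \<otimes> w [^] i = b' \<otimes> w [^] i'" "c = \<chi> b' * \<zeta> ^ i'"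
      by blast
    then show "c = \<chi> b * \<zeta> ^ i"
      using key[of b b' i i'] key[of b' b i' i] that by (cases "i \<le> i'") auto
  qed (use that in blast)
  have "\<chi> (w [^] p) \<noteq> 0" using linear_charD(1)[OF \<chi> w(2)] .
  then have \<zeta>0: "\<zeta> \<noteq> 0" using \<zeta> p by (metis power_0_left prime_gt_0_nat less_irrefl)
  have lin: "linear_char G (adjoin G B w) \<chi>'"
    unfolding linear_char_def
  proof (intro conjI ballI)
    fix x assume "x \<in> adjoin G B w"
    then obtain b and i :: nat where *: "b \<in> B" "x = b \<otimes> w [^] i"
      unfolding adjoin_def by blast
    then show "\<chi>' x \<noteq> 0" using eval \<zeta>0 linear_charD(1)[OF \<chi>] by simp
    fix y assume "y \<in> adjoin G B w"
    then obtain b' and j :: nat where **: "b' \<in> B" "y = b' \<otimes> w [^] j"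
      unfolding adjoin_def by blast
    let ?c = "w [^] i \<otimes> b' \<otimes> inv (w [^] i)"
    have c: "?c \<in> B" "\<chi> ?c = \<chi> b'"
      using conj_pow_invariant[OF B w(1) conj **(1), of i] by auto
    have "x \<otimes> y = (b \<otimes> ?c) \<otimes> w [^] (i + j)"
      unfolding * ** using B w * ** by (intro adjoin_mult) (auto simp: subgroup.mem_carrier)
    moreover have "b \<otimes> ?c \<in> B" using * c B by (auto intro: subgroup.m_closed)
    ultimately have "\<chi>' (x \<otimes> y) = \<chi> (b \<otimes> ?c) * \<zeta> ^ (i + j)" using eval by simp
    then show "\<chi>' (x \<otimes> y) = \<chi>' x * \<chi>' y"
      using * ** c linear_charD(2)[OF \<chi> *(1) c(1)] by (simp add: eval power_add)
  qed
  moreover have "\<chi>' b = \<chi> b" if "b \<in> B" for b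
    using eval[OF that, of 0] that B by (simp add: subgroup.mem_carrier)
  moreover have "\<chi>' w = \<zeta>"
    using eval[OF subgroup.one_closed[OF B], of 1] w linear_char_one[OF \<chi> B] by simp
  ultimately show ?thesis using that eval by blast
qed

lemma adjoinable_adjoin:
  assumes "adjoinable G p B S" "w \<in> S" "Factorial_Ring.prime p"
  shows "adjoinable G p (adjoin G B w) S"
proof -
  note D = adjoinableD[OF assms(1)]
  have w: "w \<in> carrier G" using D(2) assms(2) by auto
  have sub: "subgroup (adjoin G B w) G"
    using subgroup_adjoin[OF D(1) w D(3)[OF assms(2)] prime_gt_0_nat[OF assms(3)]]
      adjoinable_conj[OF assms(1,2)] by blast
  have "commutator G v x \<in> adjoin G B w" if v: "v \<in> S" and x: "x \<in> adjoin G B w \<union> S" for v x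
  proof (cases "x \<in> S")
    case True
    then show ?thesis using D(4)[OF v, of x] adjoin_incl[OF D(1) w] by blast
  next
    case False
    then obtain b and i :: nat where *: "b \<in> B" "x = b \<otimes> w [^] i"
      using x unfolding adjoin_def by blast
    have c: "v \<in> carrier G" "b \<in> carrier G" using D(1,2) v * by (auto simp: subgroup.mem_carrier)
    have "v \<otimes> w \<otimes> inv v \<in> adjoin G B w"
      using conj_commutator[of v w] c w D(4)[OF v, of w] assms(2) adjoin_incl[OF D(1) w]
        adjoin_mem[OF D(1) w] sub by (auto intro: subgroup.m_closed)
    then have "v \<otimes> w [^] i \<otimes> inv v \<in> adjoin G B w"
    proof (induction i)
      case 0
      then show ?case using c sub by (simp add: subgroup.one_closed)
    next
      case (Suc i)
      have "v \<otimes> w [^] Suc i \<otimes> inv v = (v \<otimes> w [^] i \<otimes> inv v) \<otimes> (v \<otimes> w \<otimes> inv v)"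
        using c w by (simp add: m_assoc)
      then show ?case using Suc sub by (auto intro: subgroup.m_closed)
    qed
    then have "v \<otimes> x \<otimes> inv v \<in> adjoin G B w"
      unfolding * using conj_mult[of v b "w [^] i"] c w adjoinable_conj[OF assms(1) v *(1)]
        adjoin_incl[OF D(1) w] sub by (auto intro: subgroup.m_closed)
    moreover have "inv x \<in> adjoin G B w"
      using x False sub by (auto intro: subgroup.m_inv_closed)
    ultimately show ?thesis
      unfolding commutator_def using sub by (auto intro: subgroup.m_closed)
  qed
  then show ?thesis
    unfolding adjoinable_def using sub D(2,3) adjoin_incl[OF D(1) w] by blast
qed

lemma adjoinable_foldl_adjoin:
  assumes "adjoinable G p B S" "set ws \<subseteq> S" "Factorial_Ring.prime p"
  shows "adjoinable G p (foldl (adjoin G) B ws) S"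
  using assms by (induction ws arbitrary: B) (auto intro: adjoinable_adjoin)

lemma foldl_adjoin_incl:
  assumes "adjoinable G p B S" "set ws \<subseteq> S" "Factorial_Ring.prime p"
  shows "B \<union> set ws \<subseteq> foldl (adjoin G) B ws"
  using assms
proof (induction ws arbitrary: B)
  case (Cons w ws)
  have w: "subgroup B G" "w \<in> carrier G" "w \<in> S"
    using Cons.prems adjoinableD(1,2)[OF Cons.prems(1)] by auto
  have "adjoin G B w \<union> set ws \<subseteq> foldl (adjoin G) (adjoin G B w) ws"
    using Cons.IH[OF adjoinable_adjoin[OF Cons.prems(1) w(3) Cons.prems(3)]] Cons.prems by simp
  then show ?case using adjoin_incl[OF w(1,2)] adjoin_mem[OF w(1,2)] by auto
qed auto

lemma foldl_adjoin_least:
  assumes "subgroup M G" "B \<subseteq> M" "set ws \<subseteq> M"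
  shows "foldl (adjoin G) B ws \<subseteq> M"
  using assms(2,3)
proof (induction ws arbitrary: B)
  case (Cons w ws)
  then show ?case using adjoin_least[OF assms(1), of B w] by simp
qed simp

lemma card_foldl_adjoin_le:
  assumes "adjoinable G p B S" "set ws \<subseteq> S" "Factorial_Ring.prime p" "finite B"
  shows "card (foldl (adjoin G) B ws) \<le> p ^ length ws * card B"
  using assms
proof (induction ws arbitrary: B)
  case (Cons w ws)
  note D = adjoinableD[OF Cons.prems(1)]
  have w: "w \<in> S" "w \<in> carrier G" using Cons.prems D(2) by auto
  note c = card_adjoin[OF D(1) w(2) D(3)[OF w(1)] Cons.prems(3,4)]
  have "card (foldl (adjoin G) (adjoin G B w) ws) \<le> p ^ length ws * card (adjoin G B w)"
    using Cons.IH[OF adjoinable_adjoin[OF Cons.prems(1) w(1) Cons.prems(3)] _ Cons.prems(3)] c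
      Cons.prems by auto
  also have "\<dots> \<le> p ^ length ws * (p * card B)" using c(2) by simp
  finally show ?case by (simp add: mult_ac)
qed auto

text \<open>Greedy choice of a basis of \<open>M\<close> over \<open>B\<close> inside the spanning
  set \<open>S\<close>: while the order falls short of that of \<open>M\<close>, some element of
  \<open>S\<close> is still missing, and adjoining it multiplies the order by
  \<open>p\<close>.\<close>

lemma independent_selection:
  assumes "adjoinable G p B S" "Factorial_Ring.prime p"
    and "finite (carrier G)" "M = generate G (B \<union> S)" "card M = p ^ j * card B"
  obtains ws where "length ws = j" "set ws \<subseteq> S" "independent_over G B ws" "foldl (adjoin G) B ws = M"
proof -
  have "\<exists>ws. length ws = j \<and> set ws \<subseteq> S \<and> independent_over G B ws \<and> foldl (adjoin G) B ws = M"
    using assms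
  proof (induction j arbitrary: B)
    case 0
    note D = adjoinableD[OF 0(1)]
    have "B \<subseteq> M" using 0(4) by (auto intro: generate.incl)
    moreover have "M \<subseteq> carrier G" using 0(4) D(1,2) generate_incl[of "B \<union> S"] by (simp add: subgroup.subset)
    then have "finite M" using 0(3) finite_subset by blast
    ultimately have "B = M" using 0 by (intro card_subset_eq) auto
    then show ?case by simp
  next
    case (Suc j)
    note D = adjoinableD[OF Suc.prems(1)]
    have finB: "finite B" using D(1) Suc.prems(3) finite_subset subgroup.subset by blast
    have "card B > 0" using finB subgroup.one_closed[OF D(1)] card_gt_0_iff by blast
    moreover have "p ^ Suc j > 1" using Suc.prems(2) prime_gt_1_nat one_less_power by blast
    ultimately have "B \<noteq> M" using Suc.prems(5) by auto
    have "\<not> S \<subseteq> B"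
    proof
      assume "S \<subseteq> B"
      then have "generate G (B \<union> S) \<subseteq> B" using D(1) generate_subgroup_incl[of "B \<union> S" B] by simp
      moreover have "B \<subseteq> generate G (B \<union> S)" by (auto intro: generate.incl)
      ultimately show False using \<open>B \<noteq> M\<close> Suc.prems(4) by blast
    qed
    then obtain w where w: "w \<in> S" "w \<notin> B" by blast
    have wc: "w \<in> carrier G" using w D(2) by auto
    have card: "card (adjoin G B w) = p * card B"
      using card_adjoin(3)[OF D(1) wc D(3)[OF w(1)] Suc.prems(2) finB w(2)] .
    have adj: "adjoinable G p (adjoin G B w) S" using adjoinable_adjoin[OF Suc.prems(1) w(1) Suc.prems(2)] .
    have "M = generate G (adjoin G B w \<union> S)"
    proof
      show "M \<subseteq> generate G (adjoin G B w \<union> S)"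
        unfolding Suc.prems(4) using adjoin_incl[OF D(1) wc] by (intro mono_generate) auto
      have sub: "subgroup M G" unfolding Suc.prems(4)
        using D(1,2) by (intro generate_is_subgroup) (simp add: subgroup.subset)
      have "B \<subseteq> M" "S \<subseteq> M" unfolding Suc.prems(4) by (auto intro: generate.incl)
      then show "generate G (adjoin G B w \<union> S) \<subseteq> M"
        using sub adjoin_least[OF sub \<open>B \<subseteq> M\<close>, of w] w by (intro generate_subgroup_incl) auto
    qed
    from Suc.IH[OF adj Suc.prems(2,3) this] obtain ws where
      "length ws = j" "set ws \<subseteq> S" "independent_over G (adjoin G B w) ws" "foldl (adjoin G) (adjoin G B w) ws = M"
      using Suc.prems(5) card by (auto simp: mult_ac)
    then show ?case using w by (intro exI[of _ "w # ws"]) simp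
  qed
  then show ?thesis using that by blast
qed

lemma independent_distinct:
  assumes "adjoinable G p B S" "set ws \<subseteq> S" "Factorial_Ring.prime p" "independent_over G B ws"
  shows "distinct ws \<and> set ws \<inter> B = {}"
  using assms
proof (induction ws arbitrary: B)
  case (Cons w ws)
  have w: "subgroup B G" "w \<in> carrier G" "w \<in> S"
    using Cons.prems adjoinableD(1,2)[OF Cons.prems(1)] by auto
  have "distinct ws \<and> set ws \<inter> adjoin G B w = {}"
    using Cons.IH[OF adjoinable_adjoin[OF Cons.prems(1) w(3) Cons.prems(3)]] Cons.prems by auto
  then show ?case
    using Cons.prems adjoin_incl[OF w(1,2)] adjoin_mem[OF w(1,2)] by auto
qed auto

end

section \<open>Pairings satisfying the Jacobi identity\<close>

context group
begin

text \<open>Only one commutator has to be central. The lemma is needed for \<open>G\<close> and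
  again for the extension of \<open>G\<close> defined by a cocycle with trivial pairing.\<close>

lemma commutator_mult_left:
  assumes "x \<in> carrier G" "y \<in> carrier G" "z \<in> carrier G"
    and "\<And>g. g \<in> carrier G \<Longrightarrow> commutator G y z \<otimes> g = g \<otimes> commutator G y z"
  shows "commutator G (x \<otimes> y) z = commutator G x z \<otimes> commutator G y z"
proof -
  have "commutator G (x \<otimes> y) z = x \<otimes> commutator G y z \<otimes> (z \<otimes> inv x \<otimes> inv z)"
    using assms(1-3) by (simp add: commutator_def m_assoc inv_mult_group)
  also have "\<dots> = commutator G y z \<otimes> commutator G x z"
    using assms(1-3) assms(4)[of x, symmetric] by (simp add: m_assoc commutator_def[of G x z])
  finally show ?thesis using assms by simp
qed

lemma commutator_mult_right:
  assumes "x \<in> carrier G" "y \<in> carrier G" "z \<in> carrier G"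
    and "\<And>g. g \<in> carrier G \<Longrightarrow> commutator G z x \<otimes> g = g \<otimes> commutator G z x"
  shows "commutator G x (y \<otimes> z) = commutator G x z \<otimes> commutator G x y"
  using commutator_mult_left[OF assms(2,3,1,4)] assms(1-3)
  by (metis commutator_closed commutator_inv inv_mult_group m_closed)

lemma linear_char_kernel:
  assumes "linear_char G B \<chi>" "subgroup B G"
  shows "subgroup {x \<in> B. \<chi> x = 1} G"
  using assms linear_charD(2)[OF assms(1)] linear_char_one[OF assms] linear_char_inv[OF assms]
    subgroup.subset[OF assms(2)]
  by (intro subgroupI) (auto simp: subgroup.one_closed subgroup.m_inv_closed subgroup.m_closed intro!: exI[of _ \<one>])

lemma linear_char_foldl_adjoin:
  assumes "linear_char G M \<chi>" "subgroup M G" "B \<subseteq> M" "set ws \<subseteq> M"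
    and "\<And>x. x \<in> B \<union> set ws \<Longrightarrow> \<chi> x = 1" "x \<in> foldl (adjoin G) B ws"
  shows "\<chi> x = 1"
  using foldl_adjoin_least[OF linear_char_kernel[OF assms(1,2)], of B ws] assms(3-6) by auto

end

text \<open>Here \<open>k\<close> and \<open>d\<close> are the dimensions of \<open>Z\<close> and of
  \<open>G\<close> modulo \<open>Z\<close> over F_p, read off from orders. That they are the
  generator numbers of the theorem is shown in \<open>min_gens_center\<close> and
  \<open>min_gens_carrier\<close>.\<close>

locale special_group = group G for G (structure) +
  fixes p k d :: nat
  assumes finite_carrier: "finite (carrier G)"
    and prime_p: "Factorial_Ring.prime p"
    and center_eq_derived: "group_center G = derived G (carrier G)"
    and center_exp: "z \<in> group_center G \<Longrightarrow> z [^] p = \<one>"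
    and card_center: "card (group_center G) = p ^ k"
    and card_carrier: "card (carrier G) = p ^ (d + k)"
begin

abbreviation Z where "Z \<equiv> group_center G"

lemma Z_carrier: "z \<in> Z \<Longrightarrow> z \<in> carrier G"
  by (simp add: group_center_def)

lemma Z_comm: "z \<in> Z \<Longrightarrow> x \<in> carrier G \<Longrightarrow> z \<otimes> x = x \<otimes> z"
  by (simp add: group_center_def)

lemma ZI: "z \<in> carrier G \<Longrightarrow> (\<And>x. x \<in> carrier G \<Longrightarrow> commutator G z x = \<one>) \<Longrightarrow> z \<in> Z"
  by (simp add: group_center_def commutator_eq_one_iff)

lemma subgroup_Z: "subgroup Z G"
  unfolding center_eq_derived by (rule derived_is_subgroup) simp

lemma finite_Z: "finite Z"
  using finite_carrier Z_carrier by (metis finite_subset subsetI)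

lemma commutator_Z: "x \<in> carrier G \<Longrightarrow> y \<in> carrier G \<Longrightarrow> commutator G x y \<in> Z"
  unfolding center_eq_derived derived_def commutator_def by (rule generate.incl) blast

lemma commutator_mult_l:
  "x \<in> carrier G \<Longrightarrow> y \<in> carrier G \<Longrightarrow> z \<in> carrier G \<Longrightarrow>
    commutator G (x \<otimes> y) z = commutator G x z \<otimes> commutator G y z"
  using commutator_mult_left commutator_Z Z_comm by simp

lemma commutator_mult_r:
  "x \<in> carrier G \<Longrightarrow> y \<in> carrier G \<Longrightarrow> z \<in> carrier G \<Longrightarrow>
    commutator G x (y \<otimes> z) = commutator G x y \<otimes> commutator G x z"
  using commutator_mult_right commutator_Z Z_comm by simp

lemma commutator_Z_left [simp]: "z \<in> Z \<Longrightarrow> x \<in> carrier G \<Longrightarrow> commutator G z x = \<one>"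
  by (simp add: commutator_eq_one_iff Z_carrier Z_comm)

lemma commutator_Z_right [simp]: "z \<in> Z \<Longrightarrow> x \<in> carrier G \<Longrightarrow> commutator G x z = \<one>"
  by (simp add: commutator_eq_one_iff Z_carrier Z_comm)

lemma commutator_one [simp]: "x \<in> carrier G \<Longrightarrow> commutator G \<one> x = \<one>" "x \<in> carrier G \<Longrightarrow> commutator G x \<one> = \<one>"
  by (simp_all add: subgroup.one_closed[OF subgroup_Z])

lemma commutator_pow_l:
  "x \<in> carrier G \<Longrightarrow> y \<in> carrier G \<Longrightarrow> commutator G (x [^] (n::nat)) y = commutator G x y [^] n"
  by (induction n) (simp_all add: commutator_mult_l)

lemma commutator_inv_l:
  assumes "x \<in> carrier G" "y \<in> carrier G"
  shows "commutator G (inv x) y = inv (commutator G x y)"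
proof -
  have "commutator G (inv x) y \<otimes> commutator G x y = \<one>"
    using assms commutator_mult_l[of "inv x" x y] by simp
  then show ?thesis using assms by (simp add: inv_equality)
qed

lemma commutator_inv_r:
  assumes "x \<in> carrier G" "y \<in> carrier G"
  shows "commutator G x (inv y) = inv (commutator G x y)"
  using assms commutator_inv_l[of y x] by (metis commutator_inv inv_closed)

text \<open>By bilinearity [x^p,y] = [x,y]^p, which is trivial because \<open>Z\<close> has exponent
  \<open>p\<close>.\<close>

lemma pow_p_Z: "x \<in> carrier G \<Longrightarrow> x [^] p \<in> Z"
  by (intro ZI) (simp_all add: commutator_pow_l center_exp commutator_Z)

lemma Z_least:
  assumes "subgroup M G" "\<And>x y. x \<in> carrier G \<Longrightarrow> y \<in> carrier G \<Longrightarrow> commutator G x y \<in> M"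
  shows "Z \<subseteq> M"
  unfolding center_eq_derived derived_def using assms
  by (intro generate_subgroup_incl) (auto simp: commutator_def)

lemma adjoinable_Z:
  assumes "subgroup H G" "H \<subseteq> Z" "S \<subseteq> Z"
  shows "adjoinable G p H S"
  using assms subgroup.one_closed[OF assms(1)] Z_carrier
  by (auto simp: adjoinable_def center_exp subset_eq)

lemma adjoinable_carrier: "adjoinable G p Z (carrier G)"
  using subgroup_Z pow_p_Z commutator_Z Z_carrier by (auto simp: adjoinable_def)

lemma subgroup_card_power:
  assumes "subgroup H G" "subgroup M G" "H \<subseteq> M" "M \<subseteq> Z"
  obtains r where "card M = p ^ r * card H"
proof -
  have dvd: "card L dvd p ^ (d + k)" if "subgroup L G" for L
    using lagrange[OF that] unfolding order_def card_carrier by (metis dvd_triv_right)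
  obtain a where a: "card H = p ^ a"
    using dvd[OF assms(1)] divides_primepow_nat[OF prime_p] by blast
  obtain m where m: "card M = p ^ m"
    using dvd[OF assms(2)] divides_primepow_nat[OF prime_p] by blast
  have "card H \<le> card M" using assms finite_Z by (meson card_mono finite_subset)
  then have "a \<le> m" using a m prime_gt_1_nat[OF prime_p] by simp
  then have "card M = p ^ (m - a) * card H" by (simp add: a m power_add [symmetric])
  then show ?thesis by (rule that)
qed

lemma selection_Z:
  assumes "subgroup H G" "H \<subseteq> Z" "S \<subseteq> Z" "generate G (H \<union> S) = M"
  obtains r ws where "card M = p ^ r * card H" "length ws = r" "set ws \<subseteq> S"
    "independent_over G H ws" "foldl (adjoin G) H ws = M"
proof -
  have sub: "subgroup M G"
    using assms(2,3) Z_carrier unfolding assms(4)[symmetric] by (intro generate_is_subgroup) auto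
  have "M \<subseteq> Z" unfolding assms(4)[symmetric] using assms subgroup_Z by (intro generate_subgroup_incl) auto
  moreover have "H \<subseteq> M" unfolding assms(4)[symmetric] by (auto intro: generate.incl)
  ultimately obtain r where r: "card M = p ^ r * card H"
    using subgroup_card_power[OF assms(1) sub] by blast
  show ?thesis
    using independent_selection[OF adjoinable_Z[OF assms(1-3)] prime_p finite_carrier assms(4)[symmetric] r]
      that[OF r] by blast
qed

lemma generate_Z: "H \<subseteq> Z \<Longrightarrow> generate G (H \<union> Z) = Z"
  using subgroup_Z generate_subgroup_incl[of "H \<union> Z" Z] by (auto intro: generate.incl)

abbreviation cyc where "cyc w \<equiv> adjoin G {\<one>} w"

lemma triv_Z: "subgroup {\<one>} G" "{\<one>} \<subseteq> Z"
  using triv_subgroup subgroup.one_closed[OF subgroup_Z] by auto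

lemma subgroup_cyc: "w \<in> Z \<Longrightarrow> subgroup (cyc w) G"
  using adjoinableD(1)[OF adjoinable_adjoin[OF adjoinable_Z[OF triv_Z, of "{w}"] _ prime_p, of w]] by auto

lemma cyc_self: "w \<in> Z \<Longrightarrow> w \<in> cyc w"
  using adjoin_mem[OF triv_Z(1)] Z_carrier by simp

lemma cyc_subset: "w \<in> Z \<Longrightarrow> subgroup M G \<Longrightarrow> w \<in> M \<Longrightarrow> cyc w \<subseteq> M"
  by (intro adjoin_least) (auto simp: subgroup.one_closed)

lemma card_cyc_le: "w \<in> Z \<Longrightarrow> card (cyc w) \<le> p"
  using card_adjoin(2)[OF triv_Z(1) Z_carrier _ prime_p] center_exp by simp

lemma card_cyc: "w \<in> Z \<Longrightarrow> w \<noteq> \<one> \<Longrightarrow> card (cyc w) = p"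
  using card_adjoin(3)[OF triv_Z(1) Z_carrier _ prime_p] center_exp by simp

text \<open>A nontrivial element of a line spans it: if t = s^i and \<open>s\<close> were outside
  the line of \<open>t\<close>, then \<open>p\<close> would divide i and \<open>t\<close> would be
  trivial.\<close>

lemma cyc_sym:
  assumes "s \<in> Z" "t \<in> Z" "t \<noteq> \<one>" "t \<in> cyc s"
  shows "s \<in> cyc t"
proof (rule ccontr)
  assume s: "s \<notin> cyc t"
  obtain i :: nat where i: "t = s [^] i"
    using assms(1,4) Z_carrier by (auto simp: adjoin_def)
  have "p dvd i"
    using pow_mem_subgroup_imp_dvd[OF subgroup_cyc[OF assms(2)] Z_carrier[OF assms(1)] s _ prime_p]
      cyc_self[OF assms(2)] i center_exp[OF assms(1)] subgroup.one_closed[OF subgroup_cyc[OF assms(2)]]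
    by simp
  then obtain q where "i = p * q" by blast
  then have "t = (s [^] p) [^] q" using i Z_carrier[OF assms(1)] by (simp add: nat_pow_pow)
  then show False using assms(3) center_exp[OF assms(1)] by simp
qed

lemma cyc_neq_Z: "w \<in> Z \<Longrightarrow> k \<ge> 2 \<Longrightarrow> \<not> Z \<subseteq> cyc w"
proof
  assume "w \<in> Z" "k \<ge> 2" "Z \<subseteq> cyc w"
  then have "p ^ k \<le> p ^ 1"
    using card_cyc_le[of w] card_mono[of "cyc w" Z] card_center
      card_adjoin(1)[OF triv_Z(1) Z_carrier _ prime_p, of w] center_exp by simp
  then have "k \<le> 1" using prime_gt_1_nat[OF prime_p] power_le_imp_le_exp by blast
  then show False using \<open>k \<ge> 2\<close> by simp
qed

lemma commutator_image_subgroup: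
  assumes "v \<in> carrier G"
  shows "subgroup (commutator G v ` carrier G) G"
proof (rule subgroupI)
  show "commutator G v ` carrier G \<noteq> {}" using one_closed by blast
  fix a b assume "a \<in> commutator G v ` carrier G" "b \<in> commutator G v ` carrier G"
  then obtain x y where "x \<in> carrier G" "y \<in> carrier G" "a = commutator G v x" "b = commutator G v y"
    by blast
  then show "a \<otimes> b \<in> commutator G v ` carrier G" "inv a \<in> commutator G v ` carrier G"
    using assms commutator_mult_r[of v x y, symmetric] commutator_inv_r[of v x, symmetric] by auto
qed (use assms in auto)

end

text \<open>These properties of the pairing theta of a cocycle are all that the count of values
  uses. \<open>central_ratio f\<close> is shown to be an instance for every cocycle
  \<open>f\<close>.\<close>

definition jacobi_pairing :: "('a, 'b) monoid_scheme \<Rightarrow> ('a \<Rightarrow> 'a \<Rightarrow> complex) \<Rightarrow> bool" where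
  "jacobi_pairing G b \<longleftrightarrow>
     (\<forall>z\<in>group_center G. linear_char G (carrier G) (\<lambda>x. b x z)) \<and>
     (\<forall>x\<in>carrier G. linear_char G (group_center G) (b x)) \<and>
     (\<forall>x\<in>carrier G. \<forall>y\<in>carrier G. \<forall>w\<in>carrier G.
        b y (commutator G x w) = b x (commutator G y w) * b w (commutator G x y))"

text \<open>Phrased as a vanishing criterion: applied to the pairing of a quotient of two cocycles
  it says that equal values on \<open>P\<close> give equal pairings. Pairings trivial on
  \<open>H\<close> stand for pairings with \<open>Z\<close> modulo \<open>H\<close>.\<close>

definition determines :: "('a, 'b) monoid_scheme \<Rightarrow> ('a \<times> 'a) set \<Rightarrow> 'a set \<Rightarrow> bool" where
  "determines G P H \<longleftrightarrow> finite P \<and> P \<subseteq> carrier G \<times> group_center G \<and>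
     (\<forall>b. jacobi_pairing G b \<longrightarrow> (\<forall>x\<in>carrier G. \<forall>z\<in>H. b x z = 1) \<longrightarrow> (\<forall>(x, z)\<in>P. b x z = 1) \<longrightarrow>
        (\<forall>x\<in>carrier G. \<forall>z\<in>group_center G. b x z = 1))"

lemma determinesI:
  assumes "finite P" "P \<subseteq> carrier G \<times> group_center G"
    and "\<And>b x z. jacobi_pairing G b \<Longrightarrow> \<forall>x\<in>carrier G. \<forall>z\<in>H. b x z = 1 \<Longrightarrow> \<forall>(x, z)\<in>P. b x z = 1 \<Longrightarrow>
      x \<in> carrier G \<Longrightarrow> z \<in> group_center G \<Longrightarrow> b x z = 1"
  shows "determines G P H"
  using assms by (simp add: determines_def)

lemma determinesD:
  assumes "determines G P H" "jacobi_pairing G b" "\<And>x z. x \<in> carrier G \<Longrightarrow> z \<in> H \<Longrightarrow> b x z = 1"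
    "\<And>x z. (x, z) \<in> P \<Longrightarrow> b x z = 1" "x \<in> carrier G" "z \<in> group_center G"
  shows "b x z = 1"
  using assms unfolding determines_def by blast

lemma card_triangle:
  shows "finite {(a, b). a \<le> b \<and> b < r}" "2 * card {(a, b). a \<le> b \<and> b < (r::nat)} = r * (r + 1)"
proof -
  have eq: "{(a, b). a \<le> b \<and> b < r} = (\<lambda>(b, a). (a, b)) ` (SIGMA b:{..<r}. {..b})"
    by auto
  show "finite {(a, b). a \<le> b \<and> b < r}" unfolding eq by simp
  have "card {(a, b). a \<le> b \<and> b < r} = (\<Sum>b<r. Suc b)"
    unfolding eq by (subst card_image) (auto intro: inj_onI)
  moreover have "2 * (\<Sum>b<r. Suc b) = r * (r + 1)" by (induction r) auto
  ultimately show "2 * card {(a, b). a \<le> b \<and> b < r} = r * (r + 1)" by simp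
qed

section \<open>Counting the values that determine a Jacobi pairing\<close>

context special_group
begin

context
  fixes b assumes jp: "jacobi_pairing G b"
begin

lemma jp_right: "x \<in> carrier G \<Longrightarrow> linear_char G Z (b x)"
  using jp by (simp add: jacobi_pairing_def)

lemma jp_jacobi:
  "x \<in> carrier G \<Longrightarrow> y \<in> carrier G \<Longrightarrow> w \<in> carrier G \<Longrightarrow>
    b y (commutator G x w) = b x (commutator G y w) * b w (commutator G x y)"
  using jp unfolding jacobi_pairing_def by blast

lemma jp_Z_trivial:
  assumes "x \<in> carrier G" "H \<subseteq> Z" "set ws \<subseteq> Z" "\<And>z. z \<in> H \<Longrightarrow> b x z = 1" "\<And>z. z \<in> set ws \<Longrightarrow> b x z = 1"
    "z \<in> foldl (adjoin G) H ws"
  shows "b x z = 1"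
  using linear_char_foldl_adjoin[OF jp_right[OF assms(1)] subgroup_Z assms(2,3) _ assms(6)] assms(4,5)
  by blast

text \<open>The Jacobi identity with \<open>v\<close> in one slot, where the factor
  \<open>b v [x,y]\<close> is 1.\<close>

lemma jp_symmetric:
  assumes v: "v \<in> carrier G" "\<And>z. z \<in> Z \<Longrightarrow> b v z = 1" and "x \<in> carrier G" "y \<in> carrier G"
  shows "b x (commutator G v y) = b y (commutator G v x)"
proof -
  have "b x (commutator G v y) = b v (commutator G x y) * b y (commutator G v x)"
    by (rule jp_jacobi[OF v(1) assms(3,4)])
  then show ?thesis using v(2)[OF commutator_Z[OF assms(3,4)]] by simp
qed

end

text \<open>The pairs in \<open>?A\<close> make \<open>b v\<close> trivial, which yields the
  symmetry; then those in \<open>?B\<close> are the upper triangle of a symmetric matrix. Together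
  they make \<open>b\<close> trivial on \<open>H'\<close>, and \<open>P'\<close> does the
  rest.\<close>

lemma determines_step:
  assumes H: "subgroup H G" "H \<subseteq> Z" and v: "v \<in> carrier G"
    and ws: "set ws \<subseteq> Z" "foldl (adjoin G) H ws = Z"
    and ys: "set ys \<subseteq> carrier G" and H': "foldl (adjoin G) H (map (commutator G v) ys) = H'"
    and im: "\<And>x. x \<in> carrier G \<Longrightarrow> commutator G v x \<in> H'"
    and P': "determines G P' H'"
  shows "\<exists>P. determines G P H \<and> 2 * card P \<le> 2 * length ws + length ys * (length ys + 1) + 2 * card P'"
proof -
  let ?T = "{(a, b). a \<le> b \<and> b < length ys}"
  let ?A = "(\<lambda>w. (v, w)) ` set ws"
  let ?B = "(\<lambda>(i, j). (ys ! i, commutator G v (ys ! j))) ` ?T"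
  let ?P = "?A \<union> ?B \<union> P'"
  have yc: "ys ! i \<in> carrier G" if "i < length ys" for i using ys that nth_mem by blast
  have mapZ: "set (map (commutator G v) ys) \<subseteq> Z" using ys v by (auto intro: commutator_Z)
  have P: "finite ?P" "?P \<subseteq> carrier G \<times> Z"
    using P' card_triangle(1) v ws(1) yc commutator_Z by (auto simp: determines_def)
  have vanish: "b x z = 1" if jp: "jacobi_pairing G b" and bH: "\<forall>x\<in>carrier G. \<forall>z\<in>H. b x z = 1"
    and bP: "\<forall>(x, z)\<in>?P. b x z = 1" and xz: "x \<in> carrier G" "z \<in> Z" for b x z
  proof -
    have bv: "b v z = 1" if "z \<in> Z" for z
      by (rule jp_Z_trivial[OF jp v H(2) ws(1)]) (use that bH bP v ws in auto)
    have sym: "b x (commutator G v y) = b y (commutator G v x)" if "x \<in> carrier G" "y \<in> carrier G" for x y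
      by (rule jp_symmetric[OF jp v _ that]) (rule bv)
    have upper: "b (ys ! i) (commutator G v (ys ! j)) = 1" if "i \<le> j" "j < length ys" for i j
    proof -
      have "(ys ! i, commutator G v (ys ! j)) \<in> ?B"
        using that by (intro image_eqI[of _ _ "(i, j)"]) auto
      then show ?thesis using bP by blast
    qed
    have all: "b (ys ! i) (commutator G v (ys ! j)) = 1" if "i < length ys" "j < length ys" for i j
      using upper[of i j] upper[of j i] sym[OF yc[OF that(1)] yc[OF that(2)]] that by (cases "i \<le> j") auto
    have ysH': "b (ys ! i) z = 1" if "i < length ys" "z \<in> H'" for i z
      by (rule jp_Z_trivial[OF jp yc[OF that(1)] H(2) mapZ])
        (use that all[OF that(1)] bH yc in \<open>auto simp: H' in_set_conv_nth\<close>)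
    \<comment> \<open>Second use of the symmetry: the value equals \<open>b (ys ! i)\<close> at
      [v,x], an element of \<open>H'\<close>, where \<open>b (ys ! i)\<close> is already trivial. So
      vanishing passes from the finitely many \<open>ys\<close> to every \<open>x\<close>.\<close>
    have gen: "b x (commutator G v (ys ! i)) = 1" if "i < length ys" "x \<in> carrier G" for i x
      using sym[OF that(2) yc[OF that(1)]] ysH'[OF that(1) im[OF that(2)]] by simp
    have "b x z = 1" if "x \<in> carrier G" "z \<in> H'" for x z
      by (rule jp_Z_trivial[OF jp that(1) H(2) mapZ])
        (use that gen bH in \<open>auto simp: H' in_set_conv_nth\<close>)
    then show ?thesis using determinesD[OF P' jp _ _ xz] bP by blast
  qed
  have "determines G ?P H" by (intro determinesI P) (rule vanish)
  moreover have "card ?P \<le> card ?A + card ?B + card P'"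
    by (meson add_le_cancel_right card_Un_le le_trans)
  moreover have "card ?A \<le> length ws" by (metis card_image_le card_length finite_set le_trans)
  moreover have "2 * card ?B \<le> length ys * (length ys + 1)"
    unfolding card_triangle(2)[symmetric] using card_triangle(1) by (simp add: card_image_le)
  ultimately show ?thesis by (intro exI[of _ ?P]) linarith
qed

text \<open>\<open>length ys\<close> is the dimension of [v,G] modulo \<open>H\<close>, and
  \<open>H'\<close> is the product of \<open>H\<close> and [v,G]. The basis is chosen among the
  commutators [v,y] themselves, hence comes with preimages \<open>ys\<close>.\<close>

lemma commutator_dimension:
  assumes H: "subgroup H G" "H \<subseteq> Z" and v: "v \<in> carrier G"
  obtains ys H' where "set ys \<subseteq> carrier G" "foldl (adjoin G) H (map (commutator G v) ys) = H'"
    "\<And>x. x \<in> carrier G \<Longrightarrow> commutator G v x \<in> H'" "subgroup H' G" "H' \<subseteq> Z"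
    "card H' = p ^ length ys * card H"
proof -
  define S where "S = commutator G v ` carrier G"
  define M where "M = generate G (H \<union> S)"
  have S: "S \<subseteq> Z" using v commutator_Z by (auto simp: S_def)
  obtain r ws where ws: "card M = p ^ r * card H" "length ws = r" "set ws \<subseteq> S" "foldl (adjoin G) H ws = M"
    using selection_Z[OF H S] M_def by metis
  have "\<forall>w\<in>set ws. \<exists>y\<in>carrier G. commutator G v y = w" using ws(3) by (auto simp: S_def)
  then obtain \<eta> where \<eta>: "\<And>w. w \<in> set ws \<Longrightarrow> \<eta> w \<in> carrier G \<and> commutator G v (\<eta> w) = w" by metis
  have map: "map (commutator G v) (map \<eta> ws) = ws" using \<eta> by (simp add: map_idI)
  have "subgroup M G" unfolding M_def using H(2) S Z_carrier by (intro generate_is_subgroup) auto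
  moreover have "M \<subseteq> Z" unfolding M_def using H(2) S subgroup_Z by (intro generate_subgroup_incl) auto
  moreover have "commutator G v x \<in> M" if "x \<in> carrier G" for x
    unfolding M_def using that by (auto simp: S_def intro!: generate.incl)
  ultimately show ?thesis
    using \<eta> ws that[of "map \<eta> ws" M] map by auto
qed

lemma card_subgroup_pos: "subgroup H G \<Longrightarrow> card H > 0"
  using finite_carrier by (metis card_gt_0_iff empty_iff finite_subset subgroup.one_closed subgroup.subset)

lemma power_p_inj: "p ^ a * c = p ^ b * c \<Longrightarrow> c > 0 \<Longrightarrow> a = b"
  using prime_gt_1_nat[OF prime_p] by simp

lemma determines_quotient:
  assumes "subgroup H G" "H \<subseteq> Z" "card Z = p ^ j * card H"
  shows "\<exists>P. determines G P H \<and> 2 * card P \<le> j * (j + 3)"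
  using assms
proof (induction j arbitrary: H rule: less_induct)
  case (less j)
  note H = less.prems(1,2)
  show ?case
  proof (cases "Z \<subseteq> H")
    case True
    then have "determines G {} H" by (auto simp: determines_def)
    then show ?thesis by (intro exI[of _ "{}"]) simp
  next
    case False
    then obtain v x where v: "v \<in> carrier G" "x \<in> carrier G" "commutator G v x \<notin> H"
      using Z_least[OF H(1)] by blast
    obtain ys H' where ys: "set ys \<subseteq> carrier G" "foldl (adjoin G) H (map (commutator G v) ys) = H'"
      "\<And>x. x \<in> carrier G \<Longrightarrow> commutator G v x \<in> H'" "subgroup H' G" "H' \<subseteq> Z"
      "card H' = p ^ length ys * card H"
      using commutator_dimension[OF H v(1)] by blast
    have r: "length ys > 0" using ys(2) ys(3)[OF v(2)] v(3) by (cases ys) auto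
    obtain m where m: "card Z = p ^ m * card H'"
      using subgroup_card_power[OF ys(4) subgroup_Z ys(5)] by blast
    then have j: "j = m + length ys"
      using less.prems(3) ys(6) power_p_inj[of j "card H" "m + length ys"] card_subgroup_pos[OF H(1)]
      by (simp add: power_add mult_ac)
    obtain P' where P': "determines G P' H'" "2 * card P' \<le> m * (m + 3)"
      using less.IH[OF _ ys(4,5) m] j r by auto
    obtain l ws where ws: "card Z = p ^ l * card H" "length ws = l" "set ws \<subseteq> Z" "foldl (adjoin G) H ws = Z"
      using selection_Z[OF H order_refl generate_Z[OF H(2)]] by metis
    have "l = j" using ws(1) less.prems(3) power_p_inj card_subgroup_pos[OF H(1)] by metis
    obtain P where P: "determines G P H"
      "2 * card P \<le> 2 * length ws + length ys * (length ys + 1) + 2 * card P'"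
      using determines_step[OF H v(1) ws(3,4) ys(1,2,3) P'(1)] by blast
    \<comment> \<open>With r = \<open>length ys\<close>, the right side of the next inequality
      exceeds the left by 2 m (r - 1); choosing r = 1 gives no gain.\<close>
    have "1 * m \<le> length ys * m" using r by (intro mult_le_mono1) linarith
    then have "2 * j + length ys * (length ys + 1) + m * (m + 3) \<le> j * (j + 3)"
      unfolding j by (simp add: algebra_simps)
    then show ?thesis using P P'(2) ws(2) \<open>l = j\<close> by (intro exI[of _ P]) simp
  qed
qed

text \<open>Suppose every [v,G] is cyclic, and take w = [v1,v2] nontrivial and [x,y] outside its
  line. Then \<open>x\<close> commutes with \<open>v2\<close> and \<open>y\<close> with
  \<open>v1\<close>, so the commutators of x v1 with \<open>v2\<close> and \<open>y\<close> are w
  and [x,y], which do not lie on one line.\<close>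

lemma exists_noncyclic_commutators:
  assumes "k \<ge> 2"
  shows "\<exists>v\<in>carrier G. \<exists>x\<in>carrier G. \<exists>y\<in>carrier G.
    commutator G v x \<noteq> \<one> \<and> commutator G v y \<notin> cyc (commutator G v x)"
proof (rule ccontr)
  assume "\<not> ?thesis"
  then have hyp: "commutator G v y \<in> cyc (commutator G v x)"
    if "v \<in> carrier G" "x \<in> carrier G" "y \<in> carrier G" "commutator G v x \<noteq> \<one>" for v x y
    using that by blast
  have "\<not> Z \<subseteq> {\<one>}" using cyc_neq_Z[OF subgroup.one_closed[OF subgroup_Z] assms]
      adjoin_incl[OF triv_Z(1) one_closed] by blast
  then obtain v1 v2 where v: "v1 \<in> carrier G" "v2 \<in> carrier G" "commutator G v1 v2 \<noteq> \<one>"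
    using Z_least[OF triv_Z(1)] by blast
  define w where "w = commutator G v1 v2"
  have w: "w \<in> Z" "w \<noteq> \<one>" using v commutator_Z by (auto simp: w_def)
  have cw: "subgroup (cyc w) G" using subgroup_cyc[OF w(1)] .
  obtain x y where xy: "x \<in> carrier G" "y \<in> carrier G" "commutator G x y \<notin> cyc w"
    using Z_least[OF cw] cyc_neq_Z[OF w(1) assms] by blast
  have yx: "commutator G y x \<notin> cyc w"
    using xy subgroup.m_inv_closed[OF cw, of "commutator G y x"] by (auto simp: commutator_inv)
  have w': "commutator G v2 v1 \<noteq> \<one>" "commutator G v2 v1 \<in> cyc w"
    using subgroup.m_inv_closed[OF cw cyc_self[OF w(1)]] commutator_inv[OF v(2,1)] commutator_inv[OF v(1,2)] v(3)
    unfolding w_def by (metis inv_one, simp)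
  \<comment> \<open>A nontrivial [u,v] inside the line of \<open>w\<close> would, by
    \<open>hyp\<close> at \<open>u\<close>, put [u,u'] into that line as well.\<close>
  have triv: "commutator G u v = \<one>"
    if "u \<in> carrier G" "u' \<in> carrier G" "commutator G u u' \<notin> cyc w" "v \<in> carrier G" "commutator G v u \<in> cyc w"
    for u u' v
  proof (rule ccontr)
    assume *: "commutator G u v \<noteq> \<one>"
    have "commutator G u v \<in> cyc w"
      using that subgroup.m_inv_closed[OF cw that(5)] by (simp add: commutator_inv)
    then have "cyc (commutator G u v) \<subseteq> cyc w"
      using that cw by (intro cyc_subset) (auto intro: commutator_Z)
    then show False using hyp[OF that(1,4,2) *] that(3) by blast
  qed
  have "commutator G v2 x \<in> cyc w"
    using hyp[OF v(2,1) xy(1) w'(1)] cyc_subset[OF commutator_Z[OF v(2,1)] cw w'(2)] by blast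
  then have 1: "commutator G x v2 = \<one>" using triv xy v by blast
  have "commutator G v1 y \<in> cyc w" using hyp[OF v(1,2) xy(2) v(3)] by (simp add: w_def)
  then have "commutator G y v1 = \<one>" using triv xy(1,2) yx v by blast
  then have 2: "commutator G v1 y = \<one>" using v xy commutator_inv[of y v1] by simp
  have "commutator G (x \<otimes> v1) v2 = w" "commutator G (x \<otimes> v1) y = commutator G x y"
    using 1 2 v xy by (simp_all add: commutator_mult_l w_def)
  then show False using hyp[of "x \<otimes> v1" v2 y] v xy w(2) by simp
qed

text \<open>[v,-] is a homomorphism onto \<open>Z\<close> with kernel \<open>?C\<close>; multiplying
  kernel elements by a section \<open>s\<close> reaches all p^(d+k) elements.\<close>

lemma card_centralizer:
  assumes v: "v \<in> carrier G" and surj: "\<And>z. z \<in> Z \<Longrightarrow> \<exists>y\<in>carrier G. commutator G v y = z"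
  shows "p ^ d \<le> card {y \<in> carrier G. commutator G v y = \<one>}" (is "_ \<le> card ?C")
proof -
  obtain s where s: "\<And>z. z \<in> Z \<Longrightarrow> s z \<in> carrier G \<and> commutator G v (s z) = z"
    using surj by metis
  have fin: "finite ?C" using finite_carrier by simp
  have "carrier G \<subseteq> (\<lambda>(y, z). y \<otimes> s z) ` (?C \<times> Z)"
  proof
    fix x assume x: "x \<in> carrier G"
    define z where "z = commutator G v x"
    have z: "z \<in> Z" "s z \<in> carrier G" "commutator G v (s z) = z"
      using commutator_Z[OF v x] s by (auto simp: z_def)
    then have "x \<otimes> inv (s z) \<in> ?C" "x = (x \<otimes> inv (s z)) \<otimes> s z"
      using x v Z_carrier by (simp_all add: commutator_mult_r commutator_inv_r m_assoc z_def[symmetric])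
    then show "x \<in> (\<lambda>(y, z). y \<otimes> s z) ` (?C \<times> Z)"
      using z(1) by (intro image_eqI[of _ _ "(x \<otimes> inv (s z), z)"]) auto
  qed
  then have "card (carrier G) \<le> card (?C \<times> Z)"
    using fin finite_Z by (meson card_image_le card_mono finite_SigmaI finite_imageI le_trans)
  then have "p ^ d * p ^ k \<le> card ?C * p ^ k"
    by (simp add: card_cartesian_product card_center card_carrier power_add)
  then show ?thesis using prime_gt_0_nat[OF prime_p] by simp
qed

text \<open>The argument that a linear map for which every vector is an eigenvector is a scalar. If
  [v',g] were always on the line of [v,g], then [v',-] would agree with [v^l,-] for a single l, and
  \<open>v'\<close> would lie in \<open>Z\<close> times the powers of \<open>v\<close>.\<close>

lemma exists_independent_pair:
  assumes v: "v \<in> carrier G" and surj: "\<And>z. z \<in> Z \<Longrightarrow> \<exists>y\<in>carrier G. commutator G v y = z"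
    and v': "v' \<in> carrier G" "v' \<notin> adjoin G Z v" and k: "k \<ge> 2"
  shows "\<exists>g\<in>carrier G. commutator G v g \<noteq> \<one> \<and> commutator G v' g \<notin> cyc (commutator G v g)"
proof (rule ccontr)
  assume "\<not> ?thesis"
  then have hyp: "commutator G v' g \<in> cyc (commutator G v g)" if "g \<in> carrier G" "commutator G v g \<noteq> \<one>" for g
    using that by blast
  have "\<not> Z \<subseteq> {\<one>}" using cyc_neq_Z[OF subgroup.one_closed[OF subgroup_Z] k]
      adjoin_incl[OF triv_Z(1) one_closed] by blast
  then obtain w where w: "w \<in> Z" "w \<noteq> \<one>" by blast
  then obtain g1 where g1: "g1 \<in> carrier G" "commutator G v g1 = w" using surj by blast
  \<comment> \<open>The candidate for the scalar, read off at the single element \<open>g1\<close>;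
    the remaining task is to show that the corrected element \<open>u\<close> is central.\<close>
  obtain l :: nat where l: "commutator G v' g1 = w [^] l"
    using hyp[OF g1(1)] g1 w Z_carrier by (auto simp: adjoin_def)
  define u where "u = v' \<otimes> inv (v [^] l)"
  have u: "u \<in> carrier G" using v v' by (simp add: u_def)
  have cu: "commutator G u g = commutator G v' g \<otimes> inv (commutator G v g [^] l)" if "g \<in> carrier G" for g
    using that v v' by (simp add: u_def commutator_mult_l commutator_inv_l commutator_pow_l)
  have ug1: "commutator G u g1 = \<one>" using g1 w Z_carrier by (simp add: cu l)
  have ucyc: "commutator G u g \<in> cyc (commutator G v g)" if g: "g \<in> carrier G" "commutator G v g \<noteq> \<one>" for g
  proof -
    have "commutator G v g \<in> Z" using g v commutator_Z by blast
    note c = subgroup_cyc[OF this] cyc_self[OF this]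
    show ?thesis unfolding cu[OF g(1)]
      using hyp[OF g] c subgroup_nat_pow_closed[OF c(1,2)] by (auto intro: subgroup.m_closed subgroup.m_inv_closed)
  qed
  \<comment> \<open>A nontrivial t = [u,h] lies on the line of a = [v,h] and, as [u,g1] = 1, also on
    the line of a w, by testing h g1. So \<open>t\<close> spans both lines, whence \<open>w\<close>
    lies on the line of \<open>a\<close>, against the choice of \<open>h\<close>.\<close>
  have claim: "commutator G u h = \<one>" if h: "h \<in> carrier G" "commutator G v h \<notin> cyc w" for h
  proof (rule ccontr)
    define a t where "a = commutator G v h" and "t = commutator G u h"
    assume "commutator G u h \<noteq> \<one>"
    then have t: "t \<in> Z" "t \<noteq> \<one>" using u h commutator_Z by (auto simp: t_def)
    have a: "a \<in> Z" using v h commutator_Z by (simp add: a_def)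
    have cw: "subgroup (cyc w) G" using subgroup_cyc[OF w(1)] .
    have ct: "subgroup (cyc t) G" using subgroup_cyc[OF t(1)] .
    have a1: "a \<notin> cyc w" "a \<noteq> \<one>" using h subgroup.one_closed[OF cw] by (auto simp: a_def)
    have hg1: "commutator G v (h \<otimes> g1) = a \<otimes> w" "commutator G u (h \<otimes> g1) = t"
      using h g1 u v ug1 t Z_carrier by (simp_all add: commutator_mult_r a_def t_def)
    have aw: "a \<otimes> w \<in> Z" using a w subgroup.m_closed[OF subgroup_Z] by simp
    have "a \<otimes> w \<noteq> \<one>"
    proof
      assume "a \<otimes> w = \<one>"
      then have "a = inv w" using a w Z_carrier by (simp add: inv_equality)
      then show False using a1(1) subgroup.m_inv_closed[OF cw cyc_self[OF w(1)]] by simp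
    qed
    then have taw: "t \<in> cyc (a \<otimes> w)" using ucyc[of "h \<otimes> g1"] h g1 hg1 by simp
    have ta: "t \<in> cyc a" using ucyc[OF h(1)] a1 by (simp add: a_def t_def)
    have "a \<in> cyc t" "a \<otimes> w \<in> cyc t" using cyc_sym[OF a t ta] cyc_sym[OF aw t taw] by auto
    then have "inv a \<otimes> (a \<otimes> w) \<in> cyc t" using ct by (meson subgroup.m_closed subgroup.m_inv_closed)
    then have "w \<in> cyc t" using a w Z_carrier by simp
    then have "w \<in> cyc a" using cyc_subset[OF t(1) subgroup_cyc[OF a] ta] by blast
    then show False using cyc_sym[OF a w] a1 by blast
  qed
  \<comment> \<open>Elements \<open>g\<close> with [v,g] on the line of \<open>w\<close> are out of
    reach of \<open>claim\<close>. Multiplication by \<open>g2\<close> moves them off it, and [u,g]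
    = 1 follows from the claim for g g2 and for \<open>g2\<close>.\<close>
  obtain z where z: "z \<in> Z" "z \<notin> cyc w" using cyc_neq_Z[OF w(1) k] by blast
  then obtain g2 where g2: "g2 \<in> carrier G" "commutator G v g2 = z" using surj by blast
  have "commutator G u g = \<one>" if g: "g \<in> carrier G" for g
  proof (cases "commutator G v g \<in> cyc w")
    case True
    have cw: "subgroup (cyc w) G" using subgroup_cyc[OF w(1)] .
    have vg: "commutator G v g \<in> Z" using g v commutator_Z by blast
    have "commutator G v (g \<otimes> g2) \<notin> cyc w"
    proof
      assume "commutator G v (g \<otimes> g2) \<in> cyc w"
      then have "inv (commutator G v g) \<otimes> (commutator G v g \<otimes> z) \<in> cyc w"
        using True cw g g2 v by (auto simp: commutator_mult_r intro: subgroup.m_closed subgroup.m_inv_closed)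
      then show False using z vg Z_carrier by simp
    qed
    then have "commutator G u (g \<otimes> g2) = \<one>" using claim g g2 by simp
    moreover have "commutator G u g2 = \<one>" using claim g2 z by simp
    ultimately show ?thesis using g g2 u by (simp add: commutator_mult_r)
  qed (use claim g in blast)
  then have "u \<in> Z" using ZI[OF u] by blast
  moreover have "v' = u \<otimes> v [^] l" using v v' by (simp add: u_def m_assoc)
  ultimately show False using v'(2) by (auto simp: adjoin_def)
qed

text \<open>Trivial values at \<open>v\<close> and \<open>g\<close> cost k each; the symmetries from
  \<open>v\<close> and \<open>v'\<close> then settle the directions \<open>w1\<close> and
  \<open>w2\<close>. A triangle over the other r = k - 2 directions remains, so twice the cost is 4
  k + (k-2)(k-1) = k(k+1) + 2.\<close>

lemma determines_surjective_case:
  assumes k: "k \<ge> 2" and d: "d > k + 1"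
    and v: "v \<in> carrier G" and surj: "\<And>z. z \<in> Z \<Longrightarrow> \<exists>y\<in>carrier G. commutator G v y = z"
  shows "\<exists>P. determines G P {\<one>} \<and> 2 * card P \<le> k * (k + 1) + 4"
proof -
  \<comment> \<open>Here \<open>d > k + 1\<close> enters: \<open>Z\<close> and \<open>v\<close>
    generate at most p^(k+1) elements, while the centraliser of \<open>v\<close> has at least
    p^d.\<close>
  have "card (adjoin G Z v) \<le> p * p ^ k"
    using card_adjoin(2)[OF subgroup_Z v pow_p_Z[OF v] prime_p finite_Z] by (simp add: card_center)
  also have "\<dots> < p ^ d"
    using d prime_gt_1_nat[OF prime_p] power_strict_increasing[of "Suc k" d p] by simp
  also have "\<dots> \<le> card {y \<in> carrier G. commutator G v y = \<one>}" by (rule card_centralizer[OF v surj])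
  finally have "\<not> {y \<in> carrier G. commutator G v y = \<one>} \<subseteq> adjoin G Z v"
    using card_mono[OF card_adjoin(1)[OF subgroup_Z v pow_p_Z[OF v] prime_p finite_Z],
        of "{y \<in> carrier G. commutator G v y = \<one>}"] by linarith
  then obtain v' where v': "v' \<in> carrier G" "commutator G v v' = \<one>" "v' \<notin> adjoin G Z v" by blast
  obtain g where g: "g \<in> carrier G" "commutator G v g \<noteq> \<one>" "commutator G v' g \<notin> cyc (commutator G v g)"
    using exists_independent_pair[OF v surj v'(1,3) k] by blast
  define w1 w2 where "w1 = commutator G v g" and "w2 = commutator G v' g"
  have w: "w1 \<in> Z" "w1 \<noteq> \<one>" "w2 \<in> Z" "w2 \<notin> cyc w1"
    using g v v' commutator_Z by (auto simp: w1_def w2_def)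
  have adj: "adjoinable G p (cyc w1) Z"
    by (rule adjoinable_adjoin[OF adjoinable_Z[OF triv_Z order_refl] w(1) prime_p])
  have cyc_fin: "finite (cyc w1)" using finite_carrier
    by (meson finite_subset subgroup.subset subgroup_cyc w(1))
  have "adjoin G (cyc w1) w2 \<subseteq> Z"
    using cyc_subset[OF w(1) subgroup_Z w(1)] w(3) subgroup_Z by (metis adjoin_least)
  note H2 = adjoinableD(1)[OF adjoinable_adjoin[OF adj w(3) prime_p]] this
  have card_H2: "card (adjoin G (cyc w1) w2) = p ^ 2"
    using card_adjoin(3)[OF adjoinableD(1)[OF adj] Z_carrier[OF w(3)] adjoinableD(3)[OF adj w(3)] prime_p cyc_fin w(4)]
      card_cyc[OF w(1,2)] by (simp add: power2_eq_square)
  obtain r ws where ws: "card Z = p ^ r * card (adjoin G (cyc w1) w2)" "length ws = r" "set ws \<subseteq> Z"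
    "foldl (adjoin G) (adjoin G (cyc w1) w2) ws = Z"
    using selection_Z[OF H2 order_refl generate_Z[OF H2(2)]] by metis
  have kr: "k = r + 2"
    using ws(1) power_p_inj[of k 1 "r + 2"] unfolding card_H2 card_center power_add by simp
  \<comment> \<open>A basis of \<open>Z\<close> that begins with the two settled directions;
    \<open>ws\<close> indexes the r others.\<close>
  define bs where "bs = w1 # w2 # ws"
  have bs: "foldl (adjoin G) {\<one>} bs = Z" "set bs \<subseteq> Z" "length bs = k"
    using ws w kr by (auto simp: bs_def)
  obtain s where s: "\<And>z. z \<in> Z \<Longrightarrow> s z \<in> carrier G \<and> commutator G v (s z) = z"
    using surj by metis
  let ?T = "{(i, j). i \<le> j \<and> j < r}"
  let ?A = "(\<lambda>w. (v, w)) ` set bs"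
  let ?A' = "(\<lambda>w. (g, w)) ` set bs"
  let ?B = "(\<lambda>(i, j). (s (ws ! i), ws ! j)) ` ?T"
  let ?P = "?A \<union> ?A' \<union> ?B"
  have wsZ: "ws ! i \<in> Z" if "i < r" for i using that ws by (metis nth_mem subsetD)
  have P: "finite ?P" "?P \<subseteq> carrier G \<times> Z"
    using card_triangle(1) v g bs(2) wsZ s by auto
  have vanish: "b x z = 1" if jp: "jacobi_pairing G b" and b1: "\<forall>x\<in>carrier G. \<forall>z\<in>{\<one>}. b x z = 1"
    and bP: "\<forall>(x, z)\<in>?P. b x z = 1" and xz: "x \<in> carrier G" "z \<in> Z" for b x z
  proof -
    have onZ: "b x z = 1" if "x \<in> carrier G" "\<And>w. w \<in> set bs \<Longrightarrow> b x w = 1" "z \<in> Z" for x z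
      by (rule jp_Z_trivial[OF jp that(1) triv_Z(2) bs(2)]) (use that bs b1 in auto)
    have bv: "b v z = 1" if "z \<in> Z" for z by (rule onZ[OF v _ that]) (use bP in auto)
    have bg: "b g z = 1" if "z \<in> Z" for z by (rule onZ[OF g(1) _ that]) (use bP in auto)
    have sym: "b x (commutator G v y) = b y (commutator G v x)" if "x \<in> carrier G" "y \<in> carrier G" for x y
      by (rule jp_symmetric[OF jp v _ that]) (rule bv)
    \<comment> \<open>Every z is [v, s z], and symmetry turns its value at \<open>v'\<close> into
      the value of \<open>b (s z)\<close> at [v,v'] = 1. Thus triviality at \<open>v'\<close> costs
      no further pairs.\<close>
    have bv': "b v' z = 1" if "z \<in> Z" for z
      using sym[OF v'(1), of "s z"] s[OF that] v'(2) b1 by simp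
    have sym': "b x (commutator G v' y) = b y (commutator G v' x)" if "x \<in> carrier G" "y \<in> carrier G" for x y
      by (rule jp_symmetric[OF jp v'(1) _ that]) (rule bv')
    have bw1: "b x w1 = 1" if "x \<in> carrier G" for x
      using sym[OF that g(1)] bg[OF commutator_Z[OF v that]] by (simp add: w1_def)
    \<comment> \<open>The symmetry coming from \<open>v'\<close> saves the \<open>k - 1\<close> further values that involve \<open>s w2\<close>.\<close>
    have bw2: "b x w2 = 1" if "x \<in> carrier G" for x
      using sym'[OF that g(1)] bg[OF commutator_Z[OF v'(1) that]] by (simp add: w2_def)
    have upper: "b (s (ws ! i)) (ws ! j) = 1" if "i \<le> j" "j < r" for i j
    proof -
      have "(s (ws ! i), ws ! j) \<in> ?B"
        using that by (intro image_eqI[of _ _ "(i, j)"]) auto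
      then show ?thesis using bP by blast
    qed
    have all: "b (s (ws ! i)) (ws ! j) = 1" if "i < r" "j < r" for i j
      using upper[of i j] upper[of j i] sym[of "s (ws ! i)" "s (ws ! j)"] s[OF wsZ[OF that(1)]] s[OF wsZ[OF that(2)]] that
      by (cases "i \<le> j") auto
    have row: "b (s (ws ! i)) z = 1" if "i < r" "z \<in> Z" for i z
      by (rule onZ[OF _ _ that(2)])
        (use s[OF wsZ[OF that(1)]] all[OF that(1)] bw1 bw2 ws(2) in \<open>auto simp: bs_def in_set_conv_nth\<close>)
    have "b x (ws ! i) = 1" if "i < r" "x \<in> carrier G" for i x
      using sym[OF that(2), of "s (ws ! i)"] s[OF wsZ[OF that(1)]] row[OF that(1) commutator_Z[OF v that(2)]] by simp
    then show ?thesis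
      by (intro onZ[OF xz(1) _ xz(2)]) (use bw1 bw2 ws(2) xz(1) in \<open>auto simp: bs_def in_set_conv_nth\<close>)
  qed
  have "determines G ?P {\<one>}" by (intro determinesI P) (rule vanish)
  moreover have "card ?P \<le> card ?A + card ?A' + card ?B"
    by (meson add_le_cancel_right card_Un_le le_trans)
  moreover have "card ?A \<le> k" "card ?A' \<le> k"
    using bs(3) by (metis card_image_le card_length finite_set le_trans)+
  moreover have "2 * card ?B \<le> r * (r + 1)"
    unfolding card_triangle(2)[symmetric] using card_triangle(1) by (simp add: card_image_le)
  moreover have "4 * k + r * (r + 1) \<le> k * (k + 1) + 4" by (simp add: kr algebra_simps)
  ultimately show ?thesis by (intro exI[of _ ?P]) linarith
qed

proposition determines_bound:
  assumes k: "k \<ge> 2" and d: "d > k + 1"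
  shows "\<exists>P. determines G P {\<one>} \<and> 2 * card P \<le> k * (k + 1) + 4"
proof -
  obtain v x y where v: "v \<in> carrier G" "x \<in> carrier G" "y \<in> carrier G"
    "commutator G v x \<noteq> \<one>" "commutator G v y \<notin> cyc (commutator G v x)"
    using exists_noncyclic_commutators[OF k] by blast
  have H: "subgroup {\<one>} G" "{\<one>} \<subseteq> Z" by (rule triv_Z)+
  obtain ys H' where ys: "set ys \<subseteq> carrier G" "foldl (adjoin G) {\<one>} (map (commutator G v) ys) = H'"
    "\<And>x. x \<in> carrier G \<Longrightarrow> commutator G v x \<in> H'" "subgroup H' G" "H' \<subseteq> Z"
    "card H' = p ^ length ys * card {\<one>}"
    using commutator_dimension[OF H v(1)] by blast
  have w: "commutator G v x \<in> Z" using v commutator_Z by blast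
  have "cyc (commutator G v x) \<subset> H'"
    using cyc_subset[OF w ys(4)] ys(3) v(2,3,5) by blast
  then have "p < p ^ length ys"
    using psubset_card_mono[of H' "cyc (commutator G v x)"] finite_subset[OF ys(5) finite_Z]
      card_cyc[OF w v(4)] ys(6) by simp
  then have r: "length ys \<ge> 2"
    using prime_gt_1_nat[OF prime_p] by (cases "length ys"; cases "length ys - 1") auto
  obtain m where m: "card Z = p ^ m * card H'" using subgroup_card_power[OF ys(4) subgroup_Z ys(5)] by blast
  have kr: "k = m + length ys"
    using m ys(6) power_p_inj[of k 1 "m + length ys"] by (simp add: card_center power_add)
  show ?thesis
  proof (cases "m = 0")
    case True
    then have "H' = Z" using m ys(5) finite_Z by (intro card_subset_eq) auto
    \<comment> \<open>The commutators [v,y] form a subgroup, so spanning \<open>Z\<close> by them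
      makes every element of \<open>Z\<close> a single such commutator.\<close>
    have "Z \<subseteq> commutator G v ` carrier G"
      unfolding \<open>H' = Z\<close>[symmetric] ys(2)[symmetric]
    proof (rule foldl_adjoin_least[OF commutator_image_subgroup[OF v(1)]])
      show "{\<one>} \<subseteq> commutator G v ` carrier G"
        using subgroup.one_closed[OF commutator_image_subgroup[OF v(1)]] by simp
    qed (use ys(1) in auto)
    then show ?thesis using determines_surjective_case[OF k d v(1)] by blast
  next
    case False
    obtain P' where P': "determines G P' H'" "2 * card P' \<le> m * (m + 3)"
      using determines_quotient[OF ys(4,5) m] by blast
    obtain l ws where ws: "card Z = p ^ l * card {\<one>}" "length ws = l" "set ws \<subseteq> Z" "foldl (adjoin G) {\<one>} ws = Z"
      using selection_Z[OF H order_refl generate_Z[OF H(2)]] by metis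
    have "l = k" using ws(1) power_p_inj[of l 1 k] by (simp add: card_center)
    obtain P where P: "determines G P {\<one>}"
      "2 * card P \<le> 2 * length ws + length ys * (length ys + 1) + 2 * card P'"
      using determines_step[OF H v(1) ws(3,4) ys(1,2,3) P'(1)] by blast
    \<comment> \<open>With r = \<open>length ys\<close>, the slack in the next inequality is 2
      (m-1)(r-2). It vanishes for m = 1 or r = 2, which is where the constant 4 comes from.\<close>
    obtain a c where "length ys = a + 2" "m = c + 1"
      using r False by (metis Suc_eq_plus1 le_add_diff_inverse2 not0_implies_Suc)
    then have "2 * k + length ys * (length ys + 1) + m * (m + 3) \<le> k * (k + 1) + 4"
      unfolding kr by (simp add: algebra_simps)
    then show ?thesis using P P'(2) ws(2) \<open>l = k\<close> by (intro exI[of _ P]) simp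
  qed
qed

end

section \<open>The central extension of a cocycle\<close>

context group
begin

text \<open>Both sides come from moving \<open>a \<otimes> b \<otimes> c\<close> to \<open>c \<otimes> b \<otimes> a\<close>, starting with \<open>a \<otimes> b\<close> or with \<open>b \<otimes> c\<close>.\<close>

lemma commutator_jacobi:
  assumes "a \<in> carrier G" "b \<in> carrier G" "c \<in> carrier G"
    and t1: "t1 = commutator G b (commutator G a c)" "\<And>g. g \<in> carrier G \<Longrightarrow> g \<otimes> t1 = t1 \<otimes> g"
    and t2: "t2 = commutator G a (commutator G b c)" "\<And>g. g \<in> carrier G \<Longrightarrow> g \<otimes> t2 = t2 \<otimes> g"
    and t3: "t3 = commutator G c (commutator G a b)" "\<And>g. g \<in> carrier G \<Longrightarrow> g \<otimes> t3 = t3 \<otimes> g"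
    and comm: "commutator G a b \<otimes> commutator G a c = commutator G a c \<otimes> commutator G a b"
      "commutator G a b \<otimes> commutator G b c = commutator G b c \<otimes> commutator G a b"
      "commutator G a c \<otimes> commutator G b c = commutator G b c \<otimes> commutator G a c"
  shows "t1 = t2 \<otimes> t3"
proof -
  define m n q where "m = commutator G a b" and "n = commutator G a c" and "q = commutator G b c"
  note abc = assms(1-3)
  have mnq: "m \<in> carrier G" "n \<in> carrier G" "q \<in> carrier G" using abc by (auto simp: m_def n_def q_def)
  have t: "t1 \<in> carrier G" "t2 \<in> carrier G" "t3 \<in> carrier G" using abc by (auto simp: t1(1) t2(1) t3(1))
  have bn: "b \<otimes> n = t1 \<otimes> (n \<otimes> b)" using commutator_swap[of b n] abc mnq by (simp add: t1(1) n_def)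
  have aq: "a \<otimes> q = t2 \<otimes> (q \<otimes> a)" using commutator_swap[of a q] abc mnq by (simp add: t2(1) q_def)
  have cm: "c \<otimes> m = t3 \<otimes> (m \<otimes> c)" using commutator_swap[of c m] abc mnq by (simp add: t3(1) m_def)
  have ab: "a \<otimes> b = m \<otimes> (b \<otimes> a)" using commutator_swap[of a b] abc by (simp add: m_def)
  have ac: "a \<otimes> c = n \<otimes> (c \<otimes> a)" using commutator_swap[of a c] abc by (simp add: n_def)
  have bc: "b \<otimes> c = q \<otimes> (c \<otimes> b)" using commutator_swap[of b c] abc by (simp add: q_def)
  have "a \<otimes> b \<otimes> c = m \<otimes> b \<otimes> (a \<otimes> c)" using abc mnq by (simp add: ab m_assoc)
  also have "\<dots> = m \<otimes> (b \<otimes> n) \<otimes> (c \<otimes> a)" using abc mnq by (simp add: ac m_assoc)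
  also have "\<dots> = m \<otimes> t1 \<otimes> n \<otimes> (b \<otimes> c) \<otimes> a" using abc mnq t by (simp add: bn m_assoc)
  also have "\<dots> = t1 \<otimes> (m \<otimes> n \<otimes> q) \<otimes> (c \<otimes> (b \<otimes> a))"
    using abc mnq t t1(2)[of m] by (simp add: bc m_assoc [symmetric])
  finally have 1: "a \<otimes> b \<otimes> c = t1 \<otimes> (m \<otimes> n \<otimes> q) \<otimes> (c \<otimes> (b \<otimes> a))" .
  have "a \<otimes> b \<otimes> c = (a \<otimes> q) \<otimes> (c \<otimes> b)" using abc mnq by (simp add: bc m_assoc)
  also have "\<dots> = t2 \<otimes> q \<otimes> (a \<otimes> c) \<otimes> b" using abc mnq t by (simp add: aq m_assoc)
  also have "\<dots> = t2 \<otimes> q \<otimes> n \<otimes> c \<otimes> (a \<otimes> b)" using abc mnq t by (simp add: ac m_assoc)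
  also have "\<dots> = t2 \<otimes> q \<otimes> n \<otimes> (c \<otimes> m) \<otimes> (b \<otimes> a)" using abc mnq t by (simp add: ab m_assoc)
  also have "\<dots> = t2 \<otimes> ((q \<otimes> n) \<otimes> t3) \<otimes> m \<otimes> (c \<otimes> (b \<otimes> a))" using abc mnq t by (simp add: cm m_assoc)
  also have "\<dots> = (t2 \<otimes> t3) \<otimes> (q \<otimes> n \<otimes> m) \<otimes> (c \<otimes> (b \<otimes> a))"
    using abc mnq t t3(2)[of "q \<otimes> n"] by (simp add: m_assoc)
  also have "q \<otimes> n \<otimes> m = m \<otimes> n \<otimes> q"
  proof -
    have "q \<otimes> n \<otimes> m = q \<otimes> (m \<otimes> n)" using comm(1) mnq by (simp add: m_def n_def m_assoc)
    also have "\<dots> = m \<otimes> (q \<otimes> n)" using comm(2) mnq by (simp add: m_def q_def m_assoc [symmetric])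
    also have "\<dots> = m \<otimes> n \<otimes> q" using comm(3) mnq by (simp add: n_def q_def m_assoc)
    finally show ?thesis .
  qed
  finally have "t1 \<otimes> (m \<otimes> n \<otimes> q \<otimes> (c \<otimes> (b \<otimes> a))) = (t2 \<otimes> t3) \<otimes> (m \<otimes> n \<otimes> q \<otimes> (c \<otimes> (b \<otimes> a)))"
    using 1 abc mnq t by (simp add: m_assoc)
  then show ?thesis using abc mnq t by (meson m_closed r_cancel)
qed

end

text \<open>Cocycles need not satisfy \<open>f \<one> \<one> = 1\<close>, hence the first coordinate
  of the identity. The same factor \<open>f \<one> \<one>\<close> accompanies scalars in the lemmas
  below.\<close>

definition cocycle_ext :: "('a, 'b) monoid_scheme \<Rightarrow> ('a \<Rightarrow> 'a \<Rightarrow> complex) \<Rightarrow> (complex \<times> 'a) monoid" where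
  "cocycle_ext G f = \<lparr>carrier = {(c, x). c \<noteq> 0 \<and> x \<in> carrier G},
     monoid.mult = (\<lambda>(c, x) (c', x'). (c * c' * f x x', x \<otimes>\<^bsub>G\<^esub> x')),
     one = (inverse (f \<one>\<^bsub>G\<^esub> \<one>\<^bsub>G\<^esub>), \<one>\<^bsub>G\<^esub>)\<rparr>"

text \<open>The pairing theta: for central \<open>z\<close>, the scalar by which lifts of
  \<open>x\<close> and \<open>z\<close> fail to commute.\<close>

definition central_ratio :: "('a \<Rightarrow> 'a \<Rightarrow> complex) \<Rightarrow> 'a \<Rightarrow> 'a \<Rightarrow> complex" where
  "central_ratio f x z = f x z / f z x"

text \<open>The first coordinate of the commutator of any lifts of \<open>x\<close> and
  \<open>y\<close> to the extension, as \<open>commutator_E\<close> shows.\<close>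

definition comm_factor :: "('a, 'b) monoid_scheme \<Rightarrow> ('a \<Rightarrow> 'a \<Rightarrow> complex) \<Rightarrow> 'a \<Rightarrow> 'a \<Rightarrow> complex" where
  "comm_factor G f x y = f x y / (f y x * f (commutator G x y) (y \<otimes>\<^bsub>G\<^esub> x))"

text \<open>Equivalently, \<open>(c, x) \<mapsto> c * r x\<close> is a character of the preimage of \<open>H\<close> in the extension.\<close>

definition splits :: "('a, 'b) monoid_scheme \<Rightarrow> ('a \<Rightarrow> 'a \<Rightarrow> complex) \<Rightarrow> 'a set \<Rightarrow> ('a \<Rightarrow> complex) \<Rightarrow> bool" where
  "splits G f H r \<longleftrightarrow> (\<forall>x\<in>H. r x \<noteq> 0) \<and> (\<forall>x\<in>H. \<forall>y\<in>H. r x * r y = f x y * r (x \<otimes>\<^bsub>G\<^esub> y))"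

section \<open>The extension of \<open>G\<close> by the nonzero complex numbers and characters of
  preimages of subgroups\<close>

locale cocycle = group G for G (structure) +
  fixes f assumes cocycle: "f \<in> schur_cocycles G"
begin

abbreviation E where "E \<equiv> cocycle_ext G f"

lemma f_nz [simp]: "x \<in> carrier G \<Longrightarrow> y \<in> carrier G \<Longrightarrow> f x y \<noteq> 0"
  using cocycle by (simp add: schur_cocycles_def)

lemma f_cocycle: "x \<in> carrier G \<Longrightarrow> y \<in> carrier G \<Longrightarrow> z \<in> carrier G \<Longrightarrow>
    f x y * f (x \<otimes> y) z = f y z * f x (y \<otimes> z)"
  using cocycle by (simp add: schur_cocycles_def)

lemma f_one:
  assumes "x \<in> carrier G"
  shows "f \<one> x = f \<one> \<one>" "f x \<one> = f \<one> \<one>"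
  using f_cocycle[of \<one> \<one> x] f_cocycle[of x \<one> \<one>] assms by simp_all

lemma carrier_E: "(c, x) \<in> carrier E \<longleftrightarrow> c \<noteq> 0 \<and> x \<in> carrier G"
  by (simp add: cocycle_ext_def)

lemma mult_E: "(c, x) \<otimes>\<^bsub>E\<^esub> (c', x') = (c * c' * f x x', x \<otimes> x')"
  by (simp add: cocycle_ext_def)

lemma one_E: "\<one>\<^bsub>E\<^esub> = (inverse (f \<one> \<one>), \<one>)"
  by (simp add: cocycle_ext_def)

lemma group_E: "group E"
proof (rule groupI)
  show "\<one>\<^bsub>E\<^esub> \<in> carrier E" by (simp add: one_E carrier_E)
next
  fix a b assume "a \<in> carrier E" "b \<in> carrier E"
  then show "a \<otimes>\<^bsub>E\<^esub> b \<in> carrier E" by (cases a; cases b) (simp add: carrier_E mult_E)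
next
  fix a b c assume "a \<in> carrier E" "b \<in> carrier E" "c \<in> carrier E"
  moreover obtain a1 a2 b1 b2 c1 c2 where eq: "a = (a1, a2)" "b = (b1, b2)" "c = (c1, c2)"
    by (metis surj_pair)
  ultimately have c: "a2 \<in> carrier G" "b2 \<in> carrier G" "c2 \<in> carrier G" by (simp_all add: carrier_E)
  have "a1 * b1 * c1 * (f a2 b2 * f (a2 \<otimes> b2) c2) = a1 * b1 * c1 * (f b2 c2 * f a2 (b2 \<otimes> c2))"
    by (simp only: f_cocycle[OF c])
  then show "a \<otimes>\<^bsub>E\<^esub> b \<otimes>\<^bsub>E\<^esub> c = a \<otimes>\<^bsub>E\<^esub> (b \<otimes>\<^bsub>E\<^esub> c)"
    unfolding eq mult_E prod.inject using c by (simp only: mult_ac m_assoc simp_thms)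
next
  fix a assume "a \<in> carrier E"
  then show "\<one>\<^bsub>E\<^esub> \<otimes>\<^bsub>E\<^esub> a = a"
    using f_one(1)[of "snd a"] by (cases a) (simp add: carrier_E mult_E one_E)
next
  fix a assume a: "a \<in> carrier E"
  obtain c x where cx: "a = (c, x)" by (metis surj_pair)
  let ?i = "(inverse (c * f (inv x) x * f \<one> \<one>), inv x)"
  have "?i \<in> carrier E" "?i \<otimes>\<^bsub>E\<^esub> a = \<one>\<^bsub>E\<^esub>"
    using a by (simp_all add: cx carrier_E mult_E one_E field_simps)
  then show "\<exists>y\<in>carrier E. y \<otimes>\<^bsub>E\<^esub> a = \<one>\<^bsub>E\<^esub>" by blast
qed

sublocale E: group E by (rule group_E)

lemma snd_hom: "group_hom E G snd"
  using group_E group_axioms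
  by (auto simp: group_hom_def group_hom_axioms_def hom_def carrier_E mult_E)

lemma snd_mult: "snd (a \<otimes>\<^bsub>E\<^esub> b) = snd a \<otimes> snd b"
  by (simp add: cocycle_ext_def split: prod.splits)

lemma snd_carrier: "a \<in> carrier E \<Longrightarrow> snd a \<in> carrier G"
  by (auto simp: cocycle_ext_def)

lemma snd_inv: "a \<in> carrier E \<Longrightarrow> snd (inv\<^bsub>E\<^esub> a) = inv (snd a)"
  by (rule group_hom.hom_inv[OF snd_hom])

lemma snd_pow: "a \<in> carrier E \<Longrightarrow> snd (a [^]\<^bsub>E\<^esub> (n::nat)) = snd a [^] n"
  by (rule group_hom.hom_nat_pow[OF snd_hom])

text \<open>Comparing first coordinates in a b = [a,b] b a avoids computing inverses; the scalars
  \<open>c\<close> and \<open>c'\<close> cancel.\<close>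

lemma commutator_E:
  assumes "(c, x) \<in> carrier E" "(c', y) \<in> carrier E"
  shows "commutator E (c, x) (c', y) = (comm_factor G f x y, commutator G x y)"
proof -
  define t u where "t = fst (commutator E (c, x) (c', y))" and "u = snd (commutator E (c, x) (c', y))"
  have tu: "commutator E (c, x) (c', y) = (t, u)" by (simp add: t_def u_def)
  have u: "u = commutator G x y"
    using assms by (simp add: u_def commutator_def snd_mult snd_inv)
  have xy: "x \<in> carrier G" "y \<in> carrier G" "c \<noteq> 0" "c' \<noteq> 0" using assms by (simp_all add: carrier_E)
  have "c * c' * f x y = t * (c' * c * f y x) * f u (y \<otimes> x)"
    using E.commutator_swap[OF assms] by (simp add: tu mult_E)
  then have "t = comm_factor G f x y"
    using xy by (simp add: comm_factor_def u field_simps)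
  then show ?thesis using tu u by simp
qed

definition lift where "lift H = {(c, x). c \<noteq> (0::complex) \<and> x \<in> H}"

lemma subgroup_lift: "subgroup H G \<Longrightarrow> subgroup (lift H) E"
proof (rule E.subgroupI)
  assume H: "subgroup H G"
  show "lift H \<subseteq> carrier E" using H by (auto simp: lift_def carrier_E subgroup.mem_carrier)
  show "lift H \<noteq> {}" using subgroup.one_closed[OF H] by (auto simp: lift_def intro!: exI[of _ 1])
  fix a b assume ab: "a \<in> lift H" "b \<in> lift H"
  then have ab': "a \<in> carrier E" "b \<in> carrier E" using \<open>lift H \<subseteq> carrier E\<close> by auto
  have "fst (inv\<^bsub>E\<^esub> a) \<noteq> 0" using E.inv_closed[OF ab'(1)] by (cases "inv\<^bsub>E\<^esub> a") (simp add: carrier_E)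
  moreover have "snd (inv\<^bsub>E\<^esub> a) \<in> H" using ab H by (auto simp: snd_inv[OF ab'(1)] lift_def subgroup.m_inv_closed)
  ultimately show "inv\<^bsub>E\<^esub> a \<in> lift H" by (cases "inv\<^bsub>E\<^esub> a") (simp add: lift_def)
  show "a \<otimes>\<^bsub>E\<^esub> b \<in> lift H" using ab H by (auto simp: lift_def mult_E subgroup.m_closed subgroup.mem_carrier)
qed

lemma lift_adjoin:
  assumes "subgroup H G" "m \<in> carrier E"
  shows "lift (adjoin G H (snd m)) = adjoin E (lift H) m"
proof (intro equalityI subsetI)
  fix a assume "a \<in> lift (adjoin G H (snd m))"
  then obtain c h and i :: nat where a: "a = (c, h \<otimes> snd m [^] i)" "c \<noteq> 0" "h \<in> H"
    by (auto simp: lift_def adjoin_def)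
  obtain e where e: "m [^]\<^bsub>E\<^esub> i = (e, snd m [^] i)" using snd_pow[OF assms(2), of i] by (metis prod.collapse)
  have "e \<noteq> 0" using E.nat_pow_closed[OF assms(2), of i] by (simp add: e carrier_E)
  have h: "h \<in> carrier G" "snd m \<in> carrier G"
    using a assms by (auto simp: subgroup.mem_carrier snd_carrier)
  let ?b = "(c / (e * f h (snd m [^] i)), h)"
  have "?b \<in> lift H" "a = ?b \<otimes>\<^bsub>E\<^esub> m [^]\<^bsub>E\<^esub> i"
    using a h \<open>e \<noteq> 0\<close> by (simp_all add: lift_def e mult_E)
  then show "a \<in> adjoin E (lift H) m" unfolding adjoin_def by blast
next
  fix a assume "a \<in> adjoin E (lift H) m"
  then obtain b and i :: nat where a: "a = b \<otimes>\<^bsub>E\<^esub> m [^]\<^bsub>E\<^esub> i" "b \<in> lift H" by (auto simp: adjoin_def)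
  have b: "b \<in> carrier E" using a subgroup_lift[OF assms(1)] by (simp add: subgroup.mem_carrier)
  then have "a \<in> carrier E" using a assms by simp
  moreover have "snd a \<in> adjoin G H (snd m)"
    using a(2) by (auto simp: a(1) snd_mult snd_pow[OF assms(2)] adjoin_def lift_def)
  ultimately show "a \<in> lift (adjoin G H (snd m))" by (cases a) (simp add: carrier_E lift_def)
qed

lemma splits_one: "splits G f H r \<Longrightarrow> subgroup H G \<Longrightarrow> r \<one> = f \<one> \<one>"
  using subgroup.one_closed[of H G] by (force simp: splits_def)

lemma splits_linear_char: 
  "splits G f H r \<Longrightarrow> subgroup H G \<Longrightarrow> linear_char E (lift H) (\<lambda>a. fst a * r (snd a))"
proof -
  assume r: "splits G f H r" and H: "subgroup H G"
  show ?thesis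
    unfolding linear_char_def
  proof (intro conjI ballI)
    fix a b assume ab: "a \<in> lift H" "b \<in> lift H"
    then obtain c x c' y where [simp]: "a = (c, x)" "b = (c', y)" and xy: "x \<in> H" "y \<in> H"
      by (auto simp: lift_def)
    show "fst a * r (snd a) \<noteq> 0" using ab r by (auto simp: lift_def splits_def)
    have "f x y * r (x \<otimes> y) = r x * r y" using r xy by (simp add: splits_def)
    then have "c * c' * (f x y * r (x \<otimes> y)) = c * c' * (r x * r y)" by (simp only:)
    then show "fst (a \<otimes>\<^bsub>E\<^esub> b) * r (snd (a \<otimes>\<^bsub>E\<^esub> b)) = fst a * r (snd a) * (fst b * r (snd b))"
      by (simp add: mult_E mult_ac)
  qed
qed

text \<open>The scalar c is the element (c / \<open>f \<one> \<one>\<close>, \<open>\<one>\<close>)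
  of the extension, so \<open>scalar\<close> says that \<open>\<chi>\<close> is the identity on
  scalars, i.e. a retraction.\<close>

lemma linear_char_splits:
  assumes \<chi>: "linear_char E (lift H) \<chi>" and H: "subgroup H G"
    and scalar: "\<And>c. c \<noteq> 0 \<Longrightarrow> \<chi> (c, \<one>) = c * f \<one> \<one>"
  shows "splits G f H (\<lambda>x. \<chi> (1, x))" "\<And>c x. c \<noteq> 0 \<Longrightarrow> x \<in> H \<Longrightarrow> \<chi> (c, x) = c * \<chi> (1, x)"
proof -
  show *: "\<chi> (c, x) = c * \<chi> (1, x)" if "c \<noteq> 0" "x \<in> H" for c x
  proof -
    have x: "x \<in> carrier G" using H that by (simp add: subgroup.mem_carrier)
    then have "(c, x) = (c / f \<one> \<one>, \<one>) \<otimes>\<^bsub>E\<^esub> (1, x)" by (simp add: mult_E f_one(1)[OF x])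
    moreover have "(c / f \<one> \<one>, \<one>) \<in> lift H" "(1, x) \<in> lift H"
      using that subgroup.one_closed[OF H] by (auto simp: lift_def)
    ultimately have "\<chi> (c, x) = \<chi> (c / f \<one> \<one>, \<one>) * \<chi> (1, x)"
      using linear_charD(2)[OF \<chi>] by simp
    then show ?thesis using scalar[of "c / f \<one> \<one>"] that by simp
  qed
  have "\<chi> (1, x) * \<chi> (1, y) = f x y * \<chi> (1, x \<otimes> y)" if "x \<in> H" "y \<in> H" for x y
  proof -
    have "\<chi> (1, x) * \<chi> (1, y) = \<chi> (f x y, x \<otimes> y)"
      using that linear_charD(2)[OF \<chi>, of "(1, x)" "(1, y)"] by (simp add: lift_def mult_E)
    also have "\<dots> = f x y * \<chi> (1, x \<otimes> y)"
      using that H by (intro *) (simp_all add: subgroup.m_closed subgroup.mem_carrier)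
    finally show ?thesis .
  qed
  moreover have "\<chi> (1, x) \<noteq> 0" if "x \<in> H" for x
    using linear_charD(1)[OF \<chi>, of "(1, x)"] that by (simp add: lift_def)
  ultimately show "splits G f H (\<lambda>x. \<chi> (1, x))" by (simp add: splits_def)
qed

text \<open>\<open>linear_char_adjoin\<close> in the extension, translated back. The assumption
  \<open>conj\<close> makes the character trivial on the commutators of \<open>m\<close> with the
  preimage of \<open>H\<close>, which is its invariance under conjugation by \<open>m\<close>;
  \<open>\<zeta>\<close> is the value prescribed at \<open>m\<close>.\<close>

lemma splits_adjoin:
  assumes H: "subgroup H G" and r: "splits G f H r" and m: "m \<in> carrier E" "snd m \<notin> H" "snd m [^] p \<in> H"
    and p: "Factorial_Ring.prime p"
    and conj: "\<And>b. b \<in> lift H \<Longrightarrow> commutator E m b \<in> lift H \<and>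
      fst (commutator E m b) * r (snd (commutator E m b)) = 1"
    and \<zeta>: "\<zeta> ^ p = fst (m [^]\<^bsub>E\<^esub> p) * r (snd (m [^]\<^bsub>E\<^esub> p))"
  obtains r' where "splits G f (adjoin G H (snd m)) r'" "\<And>h. h \<in> H \<Longrightarrow> r' h = r h" "fst m * r' (snd m) = \<zeta>"
proof -
  let ?\<rho> = "\<lambda>a. fst a * r (snd a)"
  have \<rho>: "linear_char E (lift H) ?\<rho>" by (rule splits_linear_char[OF r H])
  have L: "subgroup (lift H) E" by (rule subgroup_lift[OF H])
  have m0: "fst m \<noteq> 0" using m(1) by (cases m) (simp add: carrier_E)
  have mp: "m [^]\<^bsub>E\<^esub> p \<in> lift H" 
    using E.nat_pow_closed[OF m(1), of p] m(3) snd_pow[OF m(1), of p]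
    by (cases "m [^]\<^bsub>E\<^esub> p") (auto simp: lift_def carrier_E)
  have mL: "m \<notin> lift H" using m(2) by (auto simp: lift_def)
  have cj: "m \<otimes>\<^bsub>E\<^esub> b \<otimes>\<^bsub>E\<^esub> inv\<^bsub>E\<^esub> m \<in> lift H \<and> ?\<rho> (m \<otimes>\<^bsub>E\<^esub> b \<otimes>\<^bsub>E\<^esub> inv\<^bsub>E\<^esub> m) = ?\<rho> b" if b: "b \<in> lift H" for b
  proof -
    have "b \<in> carrier E" using b L by (simp add: subgroup.mem_carrier)
    then have eq: "m \<otimes>\<^bsub>E\<^esub> b \<otimes>\<^bsub>E\<^esub> inv\<^bsub>E\<^esub> m = commutator E m b \<otimes>\<^bsub>E\<^esub> b"
      using m(1) by (rule E.conj_commutator[rotated])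
    show ?thesis unfolding eq
      using conj[OF b] b linear_charD(2)[OF \<rho>, of "commutator E m b" b] subgroup.m_closed[OF L] by simp
  qed
  obtain \<chi> where \<chi>: "linear_char E (adjoin E (lift H) m) \<chi>" "\<And>b. b \<in> lift H \<Longrightarrow> \<chi> b = ?\<rho> b" "\<chi> m = \<zeta>"
    using E.linear_char_adjoin[OF L m(1) mp mL p \<rho> cj \<zeta>] by metis
  let ?H = "adjoin G H (snd m)"
  have H': "H \<subseteq> ?H" "snd m \<in> ?H" using adjoin_incl[OF H snd_carrier[OF m(1)]] adjoin_mem[OF H snd_carrier[OF m(1)]] by auto
  have eq: "lift ?H = adjoin E (lift H) m" by (rule lift_adjoin[OF H m(1)])
  have sub: "subgroup ?H G"
  proof (rule subgroup_adjoin[OF H snd_carrier[OF m(1)] m(3) prime_gt_0_nat[OF p]])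
    fix h assume "h \<in> H"
    then have "(1, h) \<in> lift H" by (simp add: lift_def)
    then have "snd (m \<otimes>\<^bsub>E\<^esub> (1, h) \<otimes>\<^bsub>E\<^esub> inv\<^bsub>E\<^esub> m) \<in> H"
      using cj[of "(1, h)"] by (auto simp: lift_def)
    then show "snd m \<otimes> h \<otimes> inv snd m \<in> H" by (simp add: snd_mult snd_inv[OF m(1)])
  qed
  have one: "(c, \<one>) \<in> lift H" if "c \<noteq> 0" for c using that subgroup.one_closed[OF H] by (simp add: lift_def)
  have scalar: "\<chi> (c, \<one>) = c * f \<one> \<one>" if "c \<noteq> 0" for c
    using \<chi>(2)[OF one[OF that]] splits_one[OF r H] by simp
  note * = linear_char_splits[OF \<chi>(1)[folded eq] sub]
  show ?thesis
  proof (rule that)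
    show "splits G f ?H (\<lambda>x. \<chi> (1, x))" by (rule *(1)) (rule scalar)
    show "\<chi> (1, h) = r h" if "h \<in> H" for h using \<chi>(2)[of "(1, h)"] that by (simp add: lift_def)
    show "fst m * \<chi> (1, snd m) = \<zeta>"
      using *(2)[OF scalar m0 H'(2)] \<chi>(3) by simp
  qed
qed

end

section \<open>The pairing of \<open>G\<close> with \<open>Z\<close> that belongs to a
  cocycle\<close>

locale special_cocycle = special_group G p k d + cocycle G f for G (structure) and p k d f
begin

lemma central_ratio_linear_l:
  assumes "z \<in> Z" shows "linear_char G (carrier G) (\<lambda>x. central_ratio f x z)"
  unfolding linear_char_def
proof (intro conjI ballI)
  note z = assms Z_carrier[OF assms]
  show "central_ratio f x z \<noteq> 0" if "x \<in> carrier G" for x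
    using that z by (simp add: central_ratio_def)
  fix x y assume x: "x \<in> carrier G" "y \<in> carrier G"
  have e: "z \<otimes> x = x \<otimes> z" "z \<otimes> y = y \<otimes> z" using x z Z_comm by auto
  have 1: "f x y * f (x \<otimes> y) z = f y z * f x (y \<otimes> z)" using f_cocycle x z by simp
  have 2: "f x z * f (x \<otimes> z) y = f z y * f x (y \<otimes> z)" using f_cocycle[of x z y] x z e by simp
  have 3: "f z x * f (x \<otimes> z) y = f x y * f z (x \<otimes> y)" using f_cocycle[of z x y] x z e by simp
  have nz: "f x y \<noteq> 0" "f x z \<noteq> 0" "f z y \<noteq> 0" "f z x \<noteq> 0" "f y z \<noteq> 0" "f (x \<otimes> y) z \<noteq> 0" "f x (y \<otimes> z) \<noteq> 0"
    "f (x \<otimes> z) y \<noteq> 0" "f z (x \<otimes> y) \<noteq> 0" using x z by auto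
  \<comment> \<open>The product of three cocycle identities, for the orders (x,y,z), (x,z,y) and
    (z,x,y), in which \<open>z\<close> moves from right to left. Cancelling common factors leaves
    multiplicativity.\<close>
  have "f x y * f (x \<otimes> y) z * (f z x * f (x \<otimes> z) y) * (f z y * f x (y \<otimes> z)) =
      f y z * f x (y \<otimes> z) * (f x y * f z (x \<otimes> y)) * (f x z * f (x \<otimes> z) y)"
    using 1 2 3 by simp
  then have "f (x \<otimes> y) z * f z x * f z y = f y z * f z (x \<otimes> y) * f x z" using nz by (simp add: field_simps)
  then show "central_ratio f (x \<otimes> y) z = central_ratio f x z * central_ratio f y z"
    using nz by (simp add: central_ratio_def field_simps)
qed

lemma central_ratio_linear_r:
  assumes "x \<in> carrier G" shows "linear_char G Z (central_ratio f x)"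
  unfolding linear_char_def
proof (intro conjI ballI)
  show "central_ratio f x z \<noteq> 0" if "z \<in> Z" for z
    using that assms Z_carrier by (simp add: central_ratio_def)
  fix z w assume zw: "z \<in> Z" "w \<in> Z"
  note c = Z_carrier[OF zw(1)] Z_carrier[OF zw(2)] assms
  have e: "z \<otimes> x = x \<otimes> z" "w \<otimes> x = x \<otimes> w" using c zw Z_comm by auto
  have 1: "f x z * f (x \<otimes> z) w = f z w * f x (z \<otimes> w)" using f_cocycle c by simp
  have 2: "f z x * f (x \<otimes> z) w = f x w * f z (x \<otimes> w)" using f_cocycle[of z x w] c e by simp
  have 3: "f z w * f (z \<otimes> w) x = f w x * f z (x \<otimes> w)" using f_cocycle[of z w x] c e by simp
  have nz: "f x z \<noteq> 0" "f z w \<noteq> 0" "f z x \<noteq> 0" "f x w \<noteq> 0" "f w x \<noteq> 0" "f (x \<otimes> z) w \<noteq> 0" "f x (z \<otimes> w) \<noteq> 0"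
    "f z (x \<otimes> w) \<noteq> 0" "f (z \<otimes> w) x \<noteq> 0" using c by auto
  have "f x z * f (x \<otimes> z) w * (f x w * f z (x \<otimes> w)) * (f z w * f (z \<otimes> w) x) =
      f z w * f x (z \<otimes> w) * (f z x * f (x \<otimes> z) w) * (f w x * f z (x \<otimes> w))"
    using 1 2 3 by simp
  then have "f x z * f x w * f (z \<otimes> w) x = f x (z \<otimes> w) * f z x * f w x" using nz by (simp add: field_simps)
  then show "central_ratio f x (z \<otimes> w) = central_ratio f x z * central_ratio f x w"
    using nz by (simp add: central_ratio_def field_simps)
qed

text \<open>For fixed \<open>w\<close> the ratio is a character of \<open>G\<close> with commutative
  target, so it is trivial on commutators and hence on \<open>Z\<close>, which they generate. Thus
  the preimage of \<open>Z\<close> is abelian, as \<open>commutator_jacobi\<close> requires.\<close>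

lemma central_ratio_Z:
  assumes "z \<in> Z" "w \<in> Z" shows "central_ratio f z w = 1"
proof -
  note lc = central_ratio_linear_l[OF assms(2)]
  have "Z \<subseteq> {x \<in> carrier G. central_ratio f x w = 1}"
  proof (rule Z_least[OF linear_char_kernel[OF lc subgroup_self]])
    fix x y assume xy: "x \<in> carrier G" "y \<in> carrier G"
    then have "central_ratio f (x \<otimes> y) w = central_ratio f (commutator G x y) w * central_ratio f (y \<otimes> x) w"
      using commutator_swap[OF xy] linear_charD(2)[OF lc, of "commutator G x y" "y \<otimes> x"] by simp
    moreover have "central_ratio f (y \<otimes> x) w = central_ratio f (x \<otimes> y) w" "central_ratio f (x \<otimes> y) w \<noteq> 0"
      using xy linear_charD[OF lc] by (simp_all add: mult.commute)
    ultimately show "commutator G x y \<in> {x \<in> carrier G. central_ratio f x w = 1}" using xy by simp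
  qed
  then show ?thesis using assms(1) by blast
qed

lemma comm_factor_Z:
  assumes "x \<in> carrier G" "z \<in> Z"
  shows "comm_factor G f x z = central_ratio f x z / f \<one> \<one>"
  using assms Z_carrier[OF assms(2)] f_one(1)[of "z \<otimes> x"] by (simp add: comm_factor_def central_ratio_def)

text \<open>\<open>commutator_jacobi\<close> applied to the lifts \<open>U x\<close>,
  \<open>U y\<close>, \<open>U w\<close>: their double commutators are the scalars theta, hence
  central, and single commutators lie over \<open>Z\<close> and commute by
  \<open>central_ratio_Z\<close>.\<close>

lemma jacobi_pairing_central_ratio: "jacobi_pairing G (central_ratio f)"
  unfolding jacobi_pairing_def
proof (intro conjI ballI)
  fix x y w assume x: "x \<in> carrier G" "y \<in> carrier G" "w \<in> carrier G"
  define U where "U x = (1::complex, x)" for x :: 'a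
  have U: "U x \<in> carrier E" "U y \<in> carrier E" "U w \<in> carrier E" using x by (auto simp: U_def carrier_E)
  let ?t = "\<lambda>x z. (central_ratio f x z / f \<one> \<one>, \<one>)"
  have c2: "commutator E (U g) (commutator E (U g') (U g'')) = ?t g (commutator G g' g'')"
    if "g \<in> carrier G" "g' \<in> carrier G" "g'' \<in> carrier G" for g g' g''
  proof -
    have gg: "U g \<in> carrier E" "U g' \<in> carrier E" "U g'' \<in> carrier E" using that by (auto simp: U_def carrier_E)
    have "commutator E (U g') (U g'') = (comm_factor G f g' g'', commutator G g' g'')"
      using commutator_E gg unfolding U_def by blast
    moreover have "(comm_factor G f g' g'', commutator G g' g'') \<in> carrier E"
      using E.commutator_closed[OF gg(2,3)] calculation by simp
    ultimately show ?thesis using commutator_E[of 1 g] gg(1) that commutator_Z[OF that(2,3)]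
      by (simp add: U_def comm_factor_Z)
  qed
  have central: "a \<otimes>\<^bsub>E\<^esub> ?t g z = ?t g z \<otimes>\<^bsub>E\<^esub> a" if "a \<in> carrier E" for a g z
    using that f_one[of "snd a"] by (cases a) (simp add: mult_E carrier_E)
  have comm: "commutator E (U g) (U g') \<otimes>\<^bsub>E\<^esub> commutator E (U h) (U h') = commutator E (U h) (U h') \<otimes>\<^bsub>E\<^esub> commutator E (U g) (U g')"
    if "g \<in> carrier G" "g' \<in> carrier G" "h \<in> carrier G" "h' \<in> carrier G" for g g' h h'
  proof -
    have z: "commutator G g g' \<in> Z" "commutator G h h' \<in> Z" using that commutator_Z by auto
    note zc = Z_carrier[OF z(1)] Z_carrier[OF z(2)]
    have "f (commutator G g g') (commutator G h h') = f (commutator G h h') (commutator G g g')"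
      using central_ratio_Z[OF z] zc by (simp add: central_ratio_def)
    then show ?thesis using that z zc Z_comm[OF z(1)] by (simp add: U_def commutator_E carrier_E mult_E)
  qed
  have "?t y (commutator G x w) = ?t x (commutator G y w) \<otimes>\<^bsub>E\<^esub> ?t w (commutator G x y)"
    by (rule E.commutator_jacobi[OF U c2[symmetric] _ c2[symmetric] _ c2[symmetric]])
      (use x central comm in auto)
  then show "central_ratio f y (commutator G x w) = central_ratio f x (commutator G y w) * central_ratio f w (commutator G x y)"
    by (simp add: mult_E)
qed (use central_ratio_linear_l central_ratio_linear_r in auto)

lemma central_ratio_root:
  assumes "x \<in> carrier G" "z \<in> Z" shows "central_ratio f x z ^ p = 1"
  using linear_char_pow[OF central_ratio_linear_r[OF assms(1)] subgroup_Z assms(2), of p]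
    linear_char_one[OF central_ratio_linear_r[OF assms(1)] subgroup_Z] center_exp[OF assms(2)] by simp

end

text \<open>The value, under the retraction given by \<open>r\<close>, of the commutator of lifts of
  \<open>x\<close> and \<open>y\<close>.\<close>

definition comm_value :: "('a, 'b) monoid_scheme \<Rightarrow> ('a \<Rightarrow> 'a \<Rightarrow> complex) \<Rightarrow> ('a \<Rightarrow> complex) \<Rightarrow> 'a \<Rightarrow> 'a \<Rightarrow> complex" where
  "comm_value G f r x y = comm_factor G f x y * r (commutator G x y)"

text \<open>Trivial pairing means that the preimage of \<open>Z\<close> is central, so the extension
  has class at most 2 and its commutators are bimultiplicative.\<close>

locale flat_cocycle = special_cocycle +
  assumes flat: "x \<in> carrier G \<Longrightarrow> z \<in> Z \<Longrightarrow> central_ratio f x z = 1"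
begin

lemma flat_commute: "x \<in> carrier G \<Longrightarrow> z \<in> Z \<Longrightarrow> f x z = f z x"
  using flat[of x z] Z_carrier by (simp add: central_ratio_def)

lemma lift_Z_central: "a \<in> lift Z \<Longrightarrow> b \<in> carrier E \<Longrightarrow> a \<otimes>\<^bsub>E\<^esub> b = b \<otimes>\<^bsub>E\<^esub> a"
  using Z_comm by (cases b) (auto simp: lift_def mult_E carrier_E intro: flat_commute[symmetric])

lemma commutator_E_lift:
  assumes "a \<in> carrier E" "b \<in> carrier E"
  shows "commutator E a b \<in> lift Z"
proof -
  have "commutator E a b \<in> carrier E" using assms by simp
  moreover obtain c x c' y where "a = (c, x)" "b = (c', y)" by (metis surj_pair)
  ultimately show ?thesis
    using assms commutator_E[of c x c' y] commutator_Z[of x y] by (simp add: lift_def carrier_E)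
qed

lemma commutator_E_mult_l:
  assumes "a \<in> carrier E" "b \<in> carrier E" "c \<in> carrier E"
  shows "commutator E (a \<otimes>\<^bsub>E\<^esub> b) c = commutator E a c \<otimes>\<^bsub>E\<^esub> commutator E b c"
  using assms lift_Z_central[OF commutator_E_lift] by (intro E.commutator_mult_left) auto

text \<open>[a,b]^p = [a^p,b], and a^p lies over \<open>Z\<close>, hence is central. So every lifted
  commutator may receive the value 1, and all its values are p-th roots of unity.\<close>

lemma commutator_E_pow_p:
  assumes "a \<in> carrier E" "b \<in> carrier E"
  shows "commutator E a b [^]\<^bsub>E\<^esub> p = \<one>\<^bsub>E\<^esub>"
proof -
  have "commutator E (a [^]\<^bsub>E\<^esub> n) b = commutator E a b [^]\<^bsub>E\<^esub> n" for n :: nat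
    using assms by (induction n) (simp_all add: commutator_E_mult_l E.commutator_eq_one_iff)
  moreover have "a [^]\<^bsub>E\<^esub> p \<in> lift Z"
    using E.nat_pow_closed[OF assms(1), of p] snd_pow[OF assms(1), of p] pow_p_Z[OF snd_carrier[OF assms(1)]]
    by (cases "a [^]\<^bsub>E\<^esub> p") (simp add: lift_def carrier_E)
  ultimately show ?thesis
    using assms E.commutator_eq_one_iff[of "a [^]\<^bsub>E\<^esub> p" b] lift_Z_central[of "a [^]\<^bsub>E\<^esub> p" b] by simp
qed

lemma splits_normalized_aux:
  assumes "subgroup H G" "H \<subseteq> Z" "splits G f H r" "set ps \<subseteq> carrier G \<times> carrier G"
    "independent_over G H (map (\<lambda>(x, y). commutator G x y) ps)"
  shows "\<exists>r'. splits G f (foldl (adjoin G) H (map (\<lambda>(x, y). commutator G x y) ps)) r' \<and>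
    (\<forall>h\<in>H. r' h = r h) \<and> (\<forall>(x, y)\<in>set ps. comm_value G f r' x y = 1)"
  using assms
proof (induction ps arbitrary: H r)
  case (Cons q ps)
  obtain x y where q: "q = (x, y)" by (metis surj_pair)
  have xy: "x \<in> carrier G" "y \<in> carrier G" using Cons.prems(4) by (auto simp: q)
  note H = Cons.prems(1,2) and r = Cons.prems(3)
  let ?m = "commutator E (1, x) (1, y)"
  have m: "?m = (comm_factor G f x y, commutator G x y)" "?m \<in> carrier E" "?m \<in> lift Z"
    using xy commutator_E[of 1 x 1 y] commutator_E_lift[of "(1, x)" "(1, y)"]
      E.commutator_closed[of "(1, x)" "(1, y)"] by (simp_all add: carrier_E)
  have mp: "?m [^]\<^bsub>E\<^esub> p = \<one>\<^bsub>E\<^esub>" using xy by (intro commutator_E_pow_p) (simp_all add: carrier_E)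
  have w: "commutator G x y \<in> Z" "commutator G x y \<notin> H" using xy commutator_Z Cons.prems(5) by (auto simp: q)
  have conj: "commutator E ?m b \<in> lift H \<and> fst (commutator E ?m b) * r (snd (commutator E ?m b)) = 1"
    if b: "b \<in> lift H" for b
  proof -
    have "b \<in> carrier E" using b subgroup_lift[OF H(1)] by (simp add: subgroup.mem_carrier)
    then have "commutator E ?m b = \<one>\<^bsub>E\<^esub>"
      using lift_Z_central[OF m(3)] m(2) by (simp add: E.commutator_eq_one_iff)
    then show ?thesis
      using subgroup.one_closed[OF subgroup_lift[OF H(1)]] splits_one[OF r H(1)] by (simp add: one_E)
  qed
  \<comment> \<open>The lifted commutator has trivial p-th power, so 1 is an admissible root for it.
    Independence of the commutators keeps successive prescriptions from conflicting.\<close>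
  have \<zeta>: "1 ^ p = fst (?m [^]\<^bsub>E\<^esub> p) * r (snd (?m [^]\<^bsub>E\<^esub> p))"
    unfolding mp using splits_one[OF r H(1)] by (simp add: one_E)
  have "snd ?m \<notin> H" "snd ?m [^] p \<in> H"
    using m(1) w center_exp subgroup.one_closed[OF H(1)] by auto
  then obtain r1 where r1: "splits G f (adjoin G H (snd ?m)) r1" "\<And>h. h \<in> H \<Longrightarrow> r1 h = r h"
      "fst ?m * r1 (snd ?m) = 1"
    using splits_adjoin[OF H(1) r m(2) _ _ prime_p conj \<zeta>] by metis
  let ?H = "adjoin G H (commutator G x y)"
  have adj: "adjoinable G p ?H {commutator G x y}"
    using w(1) by (intro adjoinable_adjoin[OF adjoinable_Z[OF H] _ prime_p]) auto
  have H': "subgroup ?H G" "?H \<subseteq> Z" 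
    using adjoinableD(1)[OF adj] adjoin_least[OF subgroup_Z H(2) w(1)] by auto
  have "splits G f ?H r1" using r1(1) m(1) by simp
  then obtain r2 where r2: "splits G f (foldl (adjoin G) ?H (map (\<lambda>(x, y). commutator G x y) ps)) r2"
    "\<forall>h\<in>?H. r2 h = r1 h" "\<forall>(x, y)\<in>set ps. comm_value G f r2 x y = 1"
    using Cons.IH[OF H', of r1] Cons.prems(4,5) by (auto simp: q)
  have "commutator G x y \<in> ?H" "H \<subseteq> ?H"
    using adjoin_mem[OF H(1)] adjoin_incl[OF H(1)] Z_carrier[OF w(1)] by auto
  then have "comm_value G f r2 x y = 1" "\<forall>h\<in>H. r2 h = r h"
    using r2(2) r1(2,3) m(1) by (auto simp: comm_value_def)
  then show ?case using r2 by (intro exI[of _ r2]) (simp add: q)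
qed auto

lemma splits_normalized:
  assumes "set ps \<subseteq> carrier G \<times> carrier G"
    "independent_over G {\<one>} (map (\<lambda>(x, y). commutator G x y) ps)"
    "foldl (adjoin G) {\<one>} (map (\<lambda>(x, y). commutator G x y) ps) = Z"
  shows "\<exists>r. splits G f Z r \<and> (\<forall>(x, y)\<in>set ps. comm_value G f r x y = 1)"
proof -
  have "splits G f {\<one>} (\<lambda>_. f \<one> \<one>)" by (simp add: splits_def)
  from splits_normalized_aux[OF triv_Z this assms(1,2)] show ?thesis unfolding assms(3) by blast
qed

lemma comm_value_linear:
  assumes r: "splits G f Z r" and y: "y \<in> carrier G"
  shows "linear_char G (carrier G) (\<lambda>x. comm_value G f r x y)"
proof -
  let ?\<rho> = "\<lambda>a. fst a * r (snd a)"
  note \<rho> = splits_linear_char[OF r subgroup_Z]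
  have val: "comm_value G f r x y = ?\<rho> (commutator E (c, x) (1, y))" if "x \<in> carrier G" "c \<noteq> 0" for c x
    using that y by (simp add: commutator_E carrier_E comm_value_def)
  have L: "commutator E (c, x) (1, y) \<in> lift Z" if "x \<in> carrier G" "c \<noteq> 0" for c x
    using that y by (intro commutator_E_lift) (simp_all add: carrier_E)
  show ?thesis unfolding linear_char_def
  proof (intro conjI ballI)
    fix x assume x: "x \<in> carrier G"
    show "comm_value G f r x y \<noteq> 0"
      unfolding val[OF x one_neq_zero] using linear_charD(1)[OF \<rho> L[OF x one_neq_zero]] .
    fix x' assume x': "x' \<in> carrier G"
    \<comment> \<open>The product of the lifts is a lift of the product with another scalar, which
      does not affect the commutator.\<close>
    have "(1, x) \<otimes>\<^bsub>E\<^esub> (1, x') = (f x x', x \<otimes> x')" by (simp add: mult_E)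
    moreover have "commutator E ((1, x) \<otimes>\<^bsub>E\<^esub> (1, x')) (1, y) = commutator E (1, x) (1, y) \<otimes>\<^bsub>E\<^esub> commutator E (1, x') (1, y)"
      using x x' y by (intro commutator_E_mult_l) (simp_all add: carrier_E)
    ultimately have "?\<rho> (commutator E (f x x', x \<otimes> x') (1, y)) =
        ?\<rho> (commutator E (1, x) (1, y)) * ?\<rho> (commutator E (1, x') (1, y))"
      using linear_charD(2)[OF \<rho> L[OF x one_neq_zero] L[OF x' one_neq_zero]] by simp
    then show "comm_value G f r (x \<otimes> x') y = comm_value G f r x y * comm_value G f r x' y"
      using val[of "x \<otimes> x'" "f x x'"] val[OF x one_neq_zero] val[OF x' one_neq_zero] x x' by simp
  qed
qed

lemma comm_value_commute_one:
  assumes r: "splits G f Z r" and x: "x \<in> carrier G" "y \<in> carrier G"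
    and e: "(1, x) \<otimes>\<^bsub>E\<^esub> (1, y) = (1, y) \<otimes>\<^bsub>E\<^esub> (1, x)"
  shows "comm_value G f r x y = 1"
proof -
  have "commutator E (1, x) (1, y) = \<one>\<^bsub>E\<^esub>" using e x by (simp add: E.commutator_eq_one_iff carrier_E)
  then have "(comm_factor G f x y, commutator G x y) = (inverse (f \<one> \<one>), \<one>)"
    using x commutator_E[of 1 x 1 y] by (simp add: one_E carrier_E)
  then show ?thesis using splits_one[OF r subgroup_Z] by (simp add: comm_value_def)
qed

lemma comm_value_Z:
  "splits G f Z r \<Longrightarrow> z \<in> Z \<Longrightarrow> y \<in> carrier G \<Longrightarrow> comm_value G f r z y = 1"
  using lift_Z_central[of "(1, z)" "(1, y)"] 
  by (intro comm_value_commute_one) (simp_all add: Z_carrier lift_def carrier_E)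

lemma comm_value_swap:
  assumes r: "splits G f Z r" and x: "x \<in> carrier G" "y \<in> carrier G"
  shows "comm_value G f r x y * comm_value G f r y x = 1"
proof -
  let ?\<rho> = "\<lambda>a. fst a * r (snd a)"
  note \<rho> = splits_linear_char[OF r subgroup_Z]
  have c: "(1, x) \<in> carrier E" "(1, y) \<in> carrier E" using x by (simp_all add: carrier_E)
  have "?\<rho> (commutator E (1, x) (1, y) \<otimes>\<^bsub>E\<^esub> commutator E (1, y) (1, x)) = ?\<rho> \<one>\<^bsub>E\<^esub>"
    unfolding E.commutator_inv[OF c, symmetric] using c by simp
  also have "?\<rho> \<one>\<^bsub>E\<^esub> = 1" by (rule E.linear_char_one[OF \<rho> subgroup_lift[OF subgroup_Z]])
  finally show ?thesis
    using linear_charD(2)[OF \<rho> commutator_E_lift[OF c] commutator_E_lift[OF c(2,1)]]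
      commutator_E[OF c] commutator_E[OF c(2,1)] by (simp add: comm_value_def)
qed

lemma comm_value_root:
  assumes r: "splits G f Z r" and x: "x \<in> carrier G" "y \<in> carrier G"
  shows "comm_value G f r x y ^ p = 1"
  using linear_char_pow[OF comm_value_linear[OF r x(2)] subgroup_self x(1), of p]
    comm_value_Z[OF r pow_p_Z[OF x(1)] x(2)] by simp

text \<open>Agreement with \<open>r0\<close> on \<open>Z\<close> is carried along, since every
  commutator of the extension lies over \<open>Z\<close> and is therefore sent to 1 by each extended
  character. The list need not be independent: an element already in \<open>L\<close> is passed
  over.\<close>

lemma splits_extend:
  assumes r0: "splits G f Z r0" "\<And>x y. x \<in> carrier G \<Longrightarrow> y \<in> carrier G \<Longrightarrow> comm_value G f r0 x y = 1"
    and "subgroup L G" "Z \<subseteq> L" "splits G f L r" "\<forall>z\<in>Z. r z = r0 z" "set us \<subseteq> carrier G"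
  shows "\<exists>r'. splits G f (foldl (adjoin G) L us) r'"
  using assms(3-)
proof (induction us arbitrary: L r)
  case (Cons u us)
  note L = Cons.prems(1,2) and r = Cons.prems(3,4)
  have u: "u \<in> carrier G" using Cons.prems(5) by simp
  have adj: "adjoinable G p L (carrier G)"
    using L pow_p_Z commutator_Z subgroup.mem_carrier[OF L(1)] by (auto simp: adjoinable_def)
  show ?case
  proof (cases "u \<in> L")
    case True
    have "adjoin G L u = L"
      using adjoin_least[OF L(1) order_refl True] adjoin_incl[OF L(1) u] by blast
    then show ?thesis using Cons.IH[OF L r] Cons.prems(5) by simp
  next
    case False
    let ?m = "(1, u) :: complex \<times> 'a"
    have m: "?m \<in> carrier E" using u by (simp add: carrier_E)
    have up: "u [^] p \<in> L" using pow_p_Z[OF u] L by blast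
    let ?c = "fst (?m [^]\<^bsub>E\<^esub> p) * r (snd (?m [^]\<^bsub>E\<^esub> p))"
    have "?c \<noteq> 0"
      using E.nat_pow_closed[OF m, of p] snd_pow[OF m, of p] up r(1)
      by (cases "?m [^]\<^bsub>E\<^esub> p") (simp add: carrier_E splits_def)
    \<comment> \<open>Divisibility of the multiplicative group of complex numbers: a nonzero number
      has \<open>p\<close> distinct p-th roots, in particular one.\<close>
    then have "card {z. z ^ p = ?c} = p" using prime_gt_0_nat[OF prime_p] by (intro card_nth_roots)
    then have "{z. z ^ p = ?c} \<noteq> {}" using prime_gt_0_nat[OF prime_p] by (metis card.empty less_irrefl)
    then obtain \<zeta> where \<zeta>: "\<zeta> ^ p = ?c" by blast
    have conj: "commutator E ?m b \<in> lift L \<and> fst (commutator E ?m b) * r (snd (commutator E ?m b)) = 1"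
      if b: "b \<in> lift L" for b
    proof -
      have bc: "b \<in> carrier E" using b subgroup_lift[OF L(1)] by (simp add: subgroup.mem_carrier)
      then obtain c h where h: "b = (c, h)" "h \<in> carrier G" by (cases b) (simp add: carrier_E)
      have "commutator E ?m b = (comm_factor G f u h, commutator G u h)"
        using commutator_E[OF m, of c h] bc by (simp add: h)
      moreover have "commutator E ?m b \<in> lift L"
        using commutator_E_lift[OF m bc] L(2) by (auto simp: lift_def)
      ultimately show ?thesis
        using r0(2)[OF u h(2)] r(2) commutator_Z[OF u h(2)] by (simp add: comm_value_def)
    qed
    obtain r1 where r1: "splits G f (adjoin G L u) r1" "\<And>h. h \<in> L \<Longrightarrow> r1 h = r h"
      using splits_adjoin[OF L(1) r(1) m _ _ prime_p conj \<zeta>] False up by (metis snd_conv)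
    have "\<forall>z\<in>Z. r1 z = r0 z" using r1(2) r(2) L(2) by auto
    moreover have "subgroup (adjoin G L u) G" "Z \<subseteq> adjoin G L u"
      using adjoinableD(1)[OF adjoinable_adjoin[OF adj u prime_p]] adjoin_incl[OF L(1) u] L(2) by auto
    ultimately show ?thesis using Cons.IH[OF _ _ r1(1)] Cons.prems(5) by simp
  qed
qed auto

text \<open>The commutator values are bimultiplicative, trivial on \<open>Z\<close> and alternating,
  so the pairs i < j of generators modulo \<open>Z\<close> control all of them; then the retraction
  extends to the whole group.\<close>

lemma splits_carrier:
  assumes r: "splits G f Z r" and xs: "set xs \<subseteq> carrier G" "foldl (adjoin G) Z xs = carrier G"
    and one: "\<And>i j. i < j \<Longrightarrow> j < length xs \<Longrightarrow> comm_value G f r (xs ! i) (xs ! j) = 1"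
  shows "\<exists>g. splits G f (carrier G) g"
proof -
  have xc: "xs ! i \<in> carrier G" if "i < length xs" for i using that xs(1) by (metis nth_mem subsetD)
  have ext: "comm_value G f r x y = 1"
    if "y \<in> carrier G" "\<And>i. i < length xs \<Longrightarrow> comm_value G f r (xs ! i) y = 1" "x \<in> carrier G" for x y
  proof (rule linear_char_foldl_adjoin[OF comm_value_linear[OF r that(1)] subgroup_self, of Z xs])
    show "comm_value G f r x y = 1" if "x \<in> Z \<union> set xs" for x
      using that comm_value_Z[OF r] \<open>y \<in> carrier G\<close> \<open>\<And>i. i < length xs \<Longrightarrow> comm_value G f r (xs ! i) y = 1\<close>
      by (auto simp: in_set_conv_nth)
  qed (use xs that Z_carrier in auto)
  have gens: "comm_value G f r (xs ! i) (xs ! j) = 1" if "i < length xs" "j < length xs" for i j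
  proof (cases i j rule: linorder_cases)
    case equal
    then show ?thesis using xc that r by (auto intro: comm_value_commute_one)
  next
    case greater
    then show ?thesis using comm_value_swap[OF r xc[OF that(1)] xc[OF that(2)]] one[of j i] that by simp
  qed (use one that in auto)
  have 1: "comm_value G f r x (xs ! j) = 1" if "x \<in> carrier G" "j < length xs" for x j
    using ext[OF xc[OF that(2)] gens[OF _ that(2)] that(1)] by simp
  have "comm_value G f r x y = 1" if xy: "x \<in> carrier G" "y \<in> carrier G" for x y
    using ext[OF xy(2) _ xy(1)] 1[OF xy(2)] comm_value_swap[OF r _ xy(2)] xc by (metis mult.right_neutral)
  then show ?thesis
    using splits_extend[OF r _ subgroup_Z order_refl r _ xs(1)] xs(2) by auto
qed

end

section \<open>Generator numbers of \<open>G\<close> and of its centre\<close>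

context special_group
begin

lemma commutator_preimage_subgroup:
  assumes "subgroup T G" "y \<in> carrier G"
  shows "subgroup {x \<in> carrier G. commutator G x y \<in> T} G"
  using assms
  by (intro subgroupI)
    (auto simp: commutator_inv_l commutator_mult_l subgroup.m_closed subgroup.m_inv_closed subgroup.one_closed
      intro!: exI[of _ \<one>])

lemma generators:
  obtains xs where "length xs = d" "set xs \<subseteq> carrier G" "distinct xs" "foldl (adjoin G) Z xs = carrier G"
proof -
  have "generate G (Z \<union> carrier G) = carrier G"
    using generate_incl[of "Z \<union> carrier G"] Z_carrier by (auto intro: generate.incl)
  then obtain xs where "length xs = d" "set xs \<subseteq> carrier G" "independent_over G Z xs" "foldl (adjoin G) Z xs = carrier G"
    using independent_selection[OF adjoinable_carrier prime_p finite_carrier, of "carrier G" d]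
    by (metis card_carrier card_center power_add)
  then show ?thesis using that independent_distinct[OF adjoinable_carrier _ prime_p] by blast
qed

lemma commutator_mem_of_generators:
  assumes xs: "set xs \<subseteq> carrier G" "foldl (adjoin G) Z xs = carrier G" and T: "subgroup T G"
    and "\<And>a b. a \<in> set xs \<Longrightarrow> b \<in> set xs \<Longrightarrow> commutator G a b \<in> T"
    and "x \<in> carrier G" "y \<in> carrier G"
  shows "commutator G x y \<in> T"
proof -
  have ext: "commutator G x y \<in> T"
    if y: "y \<in> carrier G" and "\<And>a. a \<in> set xs \<Longrightarrow> commutator G a y \<in> T" and "x \<in> carrier G" for x y
  proof -
    have "Z \<subseteq> {x \<in> carrier G. commutator G x y \<in> T}"
      using y subgroup.one_closed[OF T] Z_carrier by auto
    moreover have "set xs \<subseteq> {x \<in> carrier G. commutator G x y \<in> T}" using that xs(1) by auto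
    ultimately have "foldl (adjoin G) Z xs \<subseteq> {x \<in> carrier G. commutator G x y \<in> T}"
      by (rule foldl_adjoin_least[OF commutator_preimage_subgroup[OF T y]])
    then show ?thesis using that(3) xs(2) by auto
  qed
  have "commutator G x b \<in> T" if "b \<in> set xs" "x \<in> carrier G" for b x
    using ext[of b x] that assms(4) xs(1) by blast
  then have "commutator G a x \<in> T" if "a \<in> set xs" "x \<in> carrier G" for a x
    using that xs(1) commutator_inv[of x a] subgroup.m_inv_closed[OF T, of "commutator G x a"] by auto
  then show ?thesis using ext[OF assms(6) _ assms(5)] assms(6) by blast
qed

text \<open>Generators modulo \<open>Z\<close> generate \<open>G\<close>, because their commutators
  generate \<open>Z\<close>. Conversely, m elements together with \<open>Z\<close> reach at most
  p^(m+k) elements.\<close>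

lemma min_gens_carrier: "min_gens G (carrier G) = d"
  unfolding min_gens_def
proof (rule Least_equality)
  obtain xs where xs: "length xs = d" "set xs \<subseteq> carrier G" "distinct xs" "foldl (adjoin G) Z xs = carrier G"
    by (rule generators)
  define T where "T = generate G (set xs)"
  have T: "subgroup T G" "set xs \<subseteq> T" "T \<subseteq> carrier G"
    using generate_is_subgroup[OF xs(2)] generate_incl[OF xs(2)] by (auto simp: T_def intro: generate.incl)
  have "Z \<subseteq> T"
  proof (rule Z_least[OF T(1)], rule commutator_mem_of_generators[OF xs(2,4) T(1)])
    fix a b assume "a \<in> set xs" "b \<in> set xs"
    then show "commutator G a b \<in> T" using T unfolding commutator_def
      by (auto intro!: subgroup.m_closed subgroup.m_inv_closed)
  qed
  then have "carrier G \<subseteq> T" using foldl_adjoin_least[OF T(1) _ T(2)] xs(4) by metis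
  then show "\<exists>S\<subseteq>carrier G. finite S \<and> card S = d \<and> generate G S = carrier G"
    using xs T(3) by (intro exI[of _ "set xs"]) (auto simp: T_def distinct_card)
next
  fix m assume "\<exists>S\<subseteq>carrier G. finite S \<and> card S = m \<and> generate G S = carrier G"
  then obtain S where S: "S \<subseteq> carrier G" "finite S" "card S = m" "generate G S = carrier G" by blast
  obtain us where us: "set us = S" "distinct us" using finite_distinct_list[OF S(2)] by blast
  let ?M = "foldl (adjoin G) Z us"
  have sub: "set us \<subseteq> carrier G" using us S by simp
  have "subgroup ?M G" "S \<subseteq> ?M"
    using adjoinableD(1)[OF adjoinable_foldl_adjoin[OF adjoinable_carrier sub prime_p]]
      foldl_adjoin_incl[OF adjoinable_carrier sub prime_p] us by auto
  then have "carrier G \<subseteq> ?M" using generate_subgroup_incl[of S ?M] S(4) by simp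
  moreover have "?M \<subseteq> carrier G" using \<open>subgroup ?M G\<close> by (rule subgroup.subset)
  ultimately have "card (carrier G) \<le> p ^ length us * card Z"
    using card_foldl_adjoin_le[OF adjoinable_carrier sub prime_p finite_Z] by (metis subset_antisym)
  then have "p ^ (d + k) \<le> p ^ (m + k)"
    using us S(3) distinct_card[OF us(2)] by (simp add: card_carrier card_center power_add)
  then have "d + k \<le> m + k" using prime_gt_1_nat[OF prime_p] power_le_imp_le_exp by blast
  then show "d \<le> m" by simp
qed

lemma min_gens_center: "min_gens G Z = k"
  unfolding min_gens_def
proof (rule Least_equality)
  obtain r ws where ws: "card Z = p ^ r * card {\<one>}" "length ws = r" "set ws \<subseteq> Z" "independent_over G {\<one>} ws"
    "foldl (adjoin G) {\<one>} ws = Z"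
    using selection_Z[OF triv_Z order_refl generate_Z[OF triv_Z(2)]] by metis
  have "r = k" using ws(1) power_p_inj[of r 1 k] by (simp add: card_center)
  have dist: "distinct ws"
    using independent_distinct[OF adjoinable_Z[OF triv_Z order_refl] ws(3) prime_p ws(4)] by simp
  have wc: "set ws \<subseteq> carrier G" using ws(3) Z_carrier by auto
  have "Z \<subseteq> generate G (set ws)"
    using foldl_adjoin_least[OF generate_is_subgroup[OF wc], of "{\<one>}" ws] ws(5)
    by (auto intro: generate.incl generate.one)
  moreover have "generate G (set ws) \<subseteq> Z" using ws(3) subgroup_Z by (rule generate_subgroup_incl)
  ultimately show "\<exists>S\<subseteq>Z. finite S \<and> card S = k \<and> generate G S = Z"
    using ws dist \<open>r = k\<close> by (intro exI[of _ "set ws"]) (auto simp: distinct_card)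
next
  fix m assume "\<exists>S\<subseteq>Z. finite S \<and> card S = m \<and> generate G S = Z"
  then obtain S where S: "S \<subseteq> Z" "finite S" "card S = m" "generate G S = Z" by blast
  obtain us where us: "set us = S" "distinct us" using finite_distinct_list[OF S(2)] by blast
  let ?M = "foldl (adjoin G) {\<one>} us"
  have sub: "set us \<subseteq> Z" using us S by simp
  note adj = adjoinable_Z[OF triv_Z order_refl]
  have "subgroup ?M G" "S \<subseteq> ?M"
    using adjoinableD(1)[OF adjoinable_foldl_adjoin[OF adj sub prime_p]]
      foldl_adjoin_incl[OF adj sub prime_p] us by auto
  then have "Z \<subseteq> ?M" using generate_subgroup_incl[of S ?M] S(4) by simp
  moreover have "?M \<subseteq> Z" by (rule foldl_adjoin_least[OF subgroup_Z triv_Z(2) sub])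
  ultimately have "card Z \<le> p ^ length us * card {\<one>}"
    using card_foldl_adjoin_le[OF adj sub prime_p] by (metis finite.emptyI finite.insertI subset_antisym)
  then have "p ^ k \<le> p ^ m"
    using us S(3) distinct_card[OF us(2)] by (simp add: card_center)
  then show "k \<le> m" using prime_gt_1_nat[OF prime_p] power_le_imp_le_exp by blast
qed

end

section \<open>The order of the Schur multiplier\<close>

lemma (in group) equiv_cohomologous: "equiv (schur_cocycles G) (cohomologous G)"
proof (rule equivI)
  show "cohomologous G \<subseteq> schur_cocycles G \<times> schur_cocycles G"
    by (auto simp: cohomologous_def)
  show "refl_on (schur_cocycles G) (cohomologous G)"
    by (auto simp: refl_on_def cohomologous_def intro!: exI[of _ "\<lambda>_. 1"])
  show "sym (cohomologous G)"
  proof (rule symI)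
    fix f f' assume "(f, f') \<in> cohomologous G"
    then obtain g where f: "f \<in> schur_cocycles G" "f' \<in> schur_cocycles G" and g: "\<forall>x\<in>carrier G. g x \<noteq> 0"
      "\<forall>x\<in>carrier G. \<forall>y\<in>carrier G. f' x y = f x y * g x * g y / g (x \<otimes> y)"
      by (auto simp: cohomologous_def)
    then have "\<forall>x\<in>carrier G. \<forall>y\<in>carrier G. f x y = f' x y * inverse (g x) * inverse (g y) / inverse (g (x \<otimes> y))"
      by (simp add: field_simps)
    then show "(f', f) \<in> cohomologous G"
      using f g(1) unfolding cohomologous_def by (auto intro!: exI[of _ "\<lambda>x. inverse (g x)"])
  qed
  show "trans (cohomologous G)"
  proof (rule transI)
    fix f f' f'' assume "(f, f') \<in> cohomologous G" "(f', f'') \<in> cohomologous G"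
    then obtain g h where f: "f \<in> schur_cocycles G" "f'' \<in> schur_cocycles G"
      and g: "\<forall>x\<in>carrier G. g x \<noteq> 0"
        "\<forall>x\<in>carrier G. \<forall>y\<in>carrier G. f' x y = f x y * g x * g y / g (x \<otimes> y)"
      and h: "\<forall>x\<in>carrier G. h x \<noteq> 0"
        "\<forall>x\<in>carrier G. \<forall>y\<in>carrier G. f'' x y = f' x y * h x * h y / h (x \<otimes> y)"
      by (auto simp: cohomologous_def)
    have "f'' x y = f x y * (g x * h x) * (g y * h y) / (g (x \<otimes> y) * h (x \<otimes> y))"
      if "x \<in> carrier G" "y \<in> carrier G" for x y
      using g(2)[rule_format, OF that] h(2)[rule_format, OF that] by (simp add: mult_ac)
    then show "(f, f'') \<in> cohomologous G"
      using f g(1) h(1) unfolding cohomologous_def by (auto intro!: exI[of _ "\<lambda>x. g x * h x"])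
  qed
qed

lemma (in group) schur_cocycles_divide:
  assumes "f \<in> schur_cocycles G" "f' \<in> schur_cocycles G"
  shows "(\<lambda>x y. f x y / f' x y) \<in> schur_cocycles G"
proof -
  have "f x y / f' x y * (f (x \<otimes> y) z / f' (x \<otimes> y) z) = f y z / f' y z * (f x (y \<otimes> z) / f' x (y \<otimes> z))"
    if "x \<in> carrier G" "y \<in> carrier G" "z \<in> carrier G" for x y z
  proof -
    have "f x y * f (x \<otimes> y) z = f y z * f x (y \<otimes> z)" "f' x y * f' (x \<otimes> y) z = f' y z * f' x (y \<otimes> z)"
      using assms that by (simp_all add: schur_cocycles_def)
    then show ?thesis by (simp only: times_divide_times_eq)
  qed
  then show ?thesis using assms by (simp add: schur_cocycles_def)
qed

text \<open>A splitting \<open>g\<close> of f/f' on the whole group writes f/f' as a coboundary; the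
  witness required by \<open>cohomologous\<close> is its pointwise inverse.\<close>

lemma (in group) cohomologousI:
  assumes "f \<in> schur_cocycles G" "f' \<in> schur_cocycles G"
    and g: "splits G (\<lambda>x y. f x y / f' x y) (carrier G) g"
  shows "(f, f') \<in> cohomologous G"
proof -
  have "f' x y = f x y * inverse (g x) * inverse (g y) / inverse (g (x \<otimes> y))"
    if "x \<in> carrier G" "y \<in> carrier G" for x y
  proof -
    have "g x * g y = f x y / f' x y * g (x \<otimes> y)" "g x \<noteq> 0" "g y \<noteq> 0" "f' x y \<noteq> 0"
      using g that assms(2) by (auto simp: splits_def schur_cocycles_def)
    then show ?thesis by (simp add: field_simps)
  qed
  then show ?thesis
    using assms g unfolding cohomologous_def
    by (auto simp: splits_def intro!: exI[of _ "\<lambda>x. inverse (g x)"])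
qed

text \<open>\<open>\<Phi>\<close> need not be constant on classes: evaluated at one chosen
  representative per class it is injective. This admits invariants that depend on choices.\<close>

lemma card_quotient_le:
  assumes "equiv S R" "finite T" "\<Phi> ` S \<subseteq> T"
    and "\<And>x y. x \<in> S \<Longrightarrow> y \<in> S \<Longrightarrow> \<Phi> x = \<Phi> y \<Longrightarrow> (x, y) \<in> R"
  shows "card (S // R) \<le> card T"
proof -
  define c where "c C = (SOME x. x \<in> S \<and> C = R `` {x})" for C
  have c: "c C \<in> S \<and> C = R `` {c C}" if "C \<in> S // R" for C
  proof -
    have "\<exists>x. x \<in> S \<and> C = R `` {x}" using quotientE[OF that] by metis
    then show ?thesis unfolding c_def by (rule someI_ex)
  qed
  have "inj_on (\<lambda>C. \<Phi> (c C)) (S // R)"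
    using c assms(4) equiv_class_eq[OF assms(1)] by (intro inj_onI) metis
  moreover have "(\<lambda>C. \<Phi> (c C)) ` (S // R) \<subseteq> T" using c assms(3) by blast
  ultimately show ?thesis using assms(2) card_inj_on_le by blast
qed

lemma splits_divide:
  assumes "splits G f H r" "splits G f' H r'"
  shows "splits G (\<lambda>x y. f x y / f' x y) H (\<lambda>x. r x / r' x)"
proof -
  have "r x / r' x * (r y / r' y) = f x y / f' x y * (r (x \<otimes>\<^bsub>G\<^esub> y) / r' (x \<otimes>\<^bsub>G\<^esub> y))" if "x \<in> H" "y \<in> H" for x y
  proof -
    have "r x * r y = f x y * r (x \<otimes>\<^bsub>G\<^esub> y)" "r' x * r' y = f' x y * r' (x \<otimes>\<^bsub>G\<^esub> y)"
      using assms that by (simp_all add: splits_def)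
    then show ?thesis by (simp only: times_divide_times_eq)
  qed
  then show ?thesis using assms by (simp add: splits_def)
qed

lemma comm_value_divide:
  "comm_value G (\<lambda>x y. f x y / f' x y) (\<lambda>x. r x / r' x) x y = comm_value G f r x y / comm_value G f' r' x y"
  by (simp add: comm_value_def comm_factor_def mult_ac)

lemma central_ratio_divide:
  "central_ratio (\<lambda>x y. f x y / f' x y) x z = central_ratio f x z / central_ratio f' x z"
  by (simp add: central_ratio_def)

lemma card_strict_triangle:
  shows "finite {(i, j). i < j \<and> j < d}" "2 * card {(i, j). i < j \<and> j < (d::nat)} = d * (d - 1)"
proof -
  have eq: "{(i, j). i < j \<and> j < d} = (\<lambda>(a, b). (a, Suc b)) ` {(a, b). a \<le> b \<and> b < d - 1}"
    by (auto simp: image_iff less_eq_Suc_le) (metis Suc_le_mono Suc_pred diff_Suc_1 less_diff_conv2 not_less_eq_eq zero_less_Suc Suc_leD Suc_le_D)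
  show "finite {(i, j). i < j \<and> j < d}" unfolding eq using card_triangle(1) by simp
  have "card {(i, j). i < j \<and> j < d} = card {(a, b). a \<le> b \<and> b < d - 1}"
    unfolding eq by (rule card_image) (auto intro: inj_onI)
  then show "2 * card {(i, j). i < j \<and> j < d} = d * (d - 1)"
    using card_triangle(2)[of "d - 1"] by (cases d) simp_all
qed

section \<open>Counting cohomology classes by two tables of p-th roots of unity\<close>

context special_group
begin

lemma special_cocycleI: "f \<in> schur_cocycles G \<Longrightarrow> special_cocycle G p k d f"
  by (simp add: special_cocycle_def cocycle_def cocycle_axioms_def special_group_axioms is_group)

text \<open>The basis of \<open>Z\<close> is returned as distinct index pairs, so that exactly k of
  the d(d-1)/2 pairs can be struck from the table of commutator values.\<close>

lemma commutator_basis: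
  assumes xs: "length xs = d" "set xs \<subseteq> carrier G" "foldl (adjoin G) Z xs = carrier G"
  defines "c \<equiv> \<lambda>(i, j). commutator G (xs ! i) (xs ! j)"
  obtains js where "set js \<subseteq> {(i, j). i < j \<and> j < d}" "distinct js" "length js = k"
    "independent_over G {\<one>} (map c js)" "foldl (adjoin G) {\<one>} (map c js) = Z"
proof -
  let ?Q = "{(i, j). i < j \<and> j < d}"
  have xc: "xs ! i \<in> carrier G" if "i < d" for i using that xs by (metis nth_mem subsetD)
  have S: "c ` ?Q \<subseteq> Z" using xc commutator_Z by (auto simp: c_def)
  define T where "T = generate G ({\<one>} \<union> c ` ?Q)"
  have T: "subgroup T G" unfolding T_def using S Z_carrier by (intro generate_is_subgroup) auto
  have TQ: "commutator G (xs ! i) (xs ! j) \<in> T" if "i < j" "j < d" for i j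
  proof -
    have "c (i, j) \<in> {\<one>} \<union> c ` ?Q" using that by blast
    then have "c (i, j) \<in> T" unfolding T_def by (rule generate.incl)
    then show ?thesis by (simp add: c_def)
  qed
  have "Z \<subseteq> T"
  proof (rule Z_least[OF T], rule commutator_mem_of_generators[OF xs(2,3) T])
    fix a b assume "a \<in> set xs" "b \<in> set xs"
    then obtain i j where ij: "i < d" "j < d" "a = xs ! i" "b = xs ! j"
      using xs(1) by (auto simp: in_set_conv_nth)
    show "commutator G a b \<in> T"
    proof (cases i j rule: linorder_cases)
      case equal
      then show ?thesis using ij xc subgroup.one_closed[OF T] by simp
    next
      case greater
      then show ?thesis
        using ij xc TQ[of j i] subgroup.m_inv_closed[OF T, of "commutator G b a"] by (simp add: commutator_inv)
    qed (use ij TQ in simp)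
  qed
  moreover have "T \<subseteq> Z" unfolding T_def using S triv_Z(2) subgroup_Z by (intro generate_subgroup_incl) auto
  ultimately have TZ: "T = Z" by blast
  obtain r ws where ws: "card T = p ^ r * card {\<one>}" "length ws = r" "set ws \<subseteq> c ` ?Q"
    "independent_over G {\<one>} ws" "foldl (adjoin G) {\<one>} ws = T"
    by (rule selection_Z[OF triv_Z S T_def[symmetric]])
  have "r = k" using ws(1) power_p_inj[of r 1 k] by (simp add: TZ card_center)
  have dist: "distinct ws"
    using independent_distinct[OF adjoinable_Z[OF triv_Z S] ws(3) prime_p ws(4)] by simp
  have "\<exists>q\<in>?Q. c q = w" if "w \<in> set ws" for w
    using subsetD[OF ws(3) that] unfolding image_iff by metis
  then obtain h where h: "\<And>w. w \<in> set ws \<Longrightarrow> h w \<in> ?Q \<and> c (h w) = w" by metis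
  have map: "map c (map h ws) = ws" using h by (simp add: map_idI)
  have "distinct (map h ws)" using map dist by (metis distinct_map)
  moreover have "set (map h ws) \<subseteq> ?Q" using h by (simp add: image_subset_iff)
  ultimately show ?thesis using that[of "map h ws"] map ws \<open>r = k\<close> TZ by simp
qed

proposition card_schur_multiplier_le:
  assumes k: "k \<ge> 2" and d: "d > k + 1"
  obtains a q where "2 * a \<le> k * (k + 1) + 4" "2 * (q + k) = d * (d - 1)"
    "schur_multiplier_order G \<le> p ^ (a + q)"
proof -
  obtain P where P: "determines G P {\<one>}" "2 * card P \<le> k * (k + 1) + 4"
    using determines_bound[OF k d] by blast
  obtain xs where xs: "length xs = d" "set xs \<subseteq> carrier G" "foldl (adjoin G) Z xs = carrier G"
    using generators by metis
  obtain js where js: "set js \<subseteq> {(i, j). i < j \<and> j < d}" "distinct js" "length js = k"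
    "independent_over G {\<one>} (map (\<lambda>(i, j). commutator G (xs ! i) (xs ! j)) js)"
    "foldl (adjoin G) {\<one>} (map (\<lambda>(i, j). commutator G (xs ! i) (xs ! j)) js) = Z"
    by (rule commutator_basis[OF xs])
  have xc: "xs ! i \<in> carrier G" if "i < d" for i using that xs by (metis nth_mem subsetD)
  define Q where "Q = {(i, j). i < j \<and> j < d} - set js"
  have Q: "finite Q" "2 * (card Q + k) = d * (d - 1)"
  proof -
    show "finite Q" using card_strict_triangle(1) by (simp add: Q_def)
    have "card Q = card {(i, j). i < j \<and> j < d} - k"
      using card_Diff_subset[OF _ js(1)] distinct_card[OF js(2)] js(3) by (simp add: Q_def)
    moreover have "k \<le> card {(i, j). i < j \<and> j < d}"
      using card_mono[OF card_strict_triangle(1) js(1)] distinct_card[OF js(2)] js(3) by simp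
    ultimately show "2 * (card Q + k) = d * (d - 1)" using card_strict_triangle(2)[of d] by simp
  qed
  define \<mu> where "\<mu> = {c::complex. c ^ p = 1}"
  have \<mu>: "finite \<mu>" "card \<mu> = p"
    using prime_gt_0_nat[OF prime_p] by (auto simp: \<mu>_def card_roots_unity_eq intro: finite_roots_unity)
  have Pfin: "finite P" "P \<subseteq> carrier G \<times> Z" using P(1) by (auto simp: determines_def)
  let ?S = "schur_cocycles G"
  define \<Phi> where "\<Phi> f = restrict (\<lambda>(x, z). central_ratio f x z) P" for f :: "'a \<Rightarrow> 'a \<Rightarrow> complex"
  \<comment> \<open>One reference cocycle for each table of pairing values on \<open>P\<close>.
    Dividing \<open>f\<close> by the reference cocycle of its own table gives \<open>h f\<close>
    with trivial pairing.\<close>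
  define F where "F t = (SOME f. f \<in> ?S \<and> \<Phi> f = t)" for t
  have F: "F (\<Phi> f) \<in> ?S" "\<Phi> (F (\<Phi> f)) = \<Phi> f" if "f \<in> ?S" for f
    using someI[of "\<lambda>g. g \<in> ?S \<and> \<Phi> g = \<Phi> f" f] that unfolding F_def by auto
  define h where "h f = (\<lambda>x y. f x y / F (\<Phi> f) x y)" for f
  \<comment> \<open>A retraction normalised on the basis pairs \<open>js\<close>, so that only the
    pairs in \<open>Q\<close> still carry information.\<close>
  define R where "R f = (SOME r. splits G (h f) Z r \<and>
      (\<forall>(i, j)\<in>set js. comm_value G (h f) r (xs ! i) (xs ! j) = 1))" for f
  define \<Psi> where "\<Psi> f = restrict (\<lambda>(i, j). comm_value G (h f) (R f) (xs ! i) (xs ! j)) Q" for f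
  have flat: "flat_cocycle G p k d (\<lambda>x y. f x y / f' x y)"
    if f: "f \<in> ?S" "f' \<in> ?S" "\<Phi> f = \<Phi> f'" for f f'
  proof -
    interpret f: special_cocycle G p k d f by (rule special_cocycleI[OF f(1)])
    interpret f': special_cocycle G p k d f' by (rule special_cocycleI[OF f(2)])
    interpret q: special_cocycle G p k d "\<lambda>x y. f x y / f' x y"
      by (rule special_cocycleI[OF schur_cocycles_divide[OF f(1,2)]])
    show ?thesis
    proof
      fix x z assume xz: "x \<in> carrier G" "z \<in> Z"
      show "central_ratio (\<lambda>x y. f x y / f' x y) x z = 1"
      proof (rule determinesD[OF P(1) q.jacobi_pairing_central_ratio _ _ xz])
        fix x z assume "x \<in> carrier G" "z \<in> {\<one>}"
        then show "central_ratio (\<lambda>x y. f x y / f' x y) x z = 1"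
          using linear_char_one[OF q.central_ratio_linear_r subgroup_Z] by simp
      next
        fix x z assume xz: "(x, z) \<in> P"
        then have "central_ratio f x z = central_ratio f' x z"
          using fun_cong[OF f(3), of "(x, z)"] by (simp add: \<Phi>_def)
        moreover have "central_ratio f' x z \<noteq> 0"
          using xz Pfin(2) linear_charD(1)[OF f'.central_ratio_linear_r] by auto
        ultimately show "central_ratio (\<lambda>x y. f x y / f' x y) x z = 1"
          by (simp add: central_ratio_divide)
      qed
    qed
  qed
  have hflat: "flat_cocycle G p k d (h f)" if "f \<in> ?S" for f
    unfolding h_def using that F[OF that] by (intro flat) auto
  have R: "splits G (h f) Z (R f) \<and> (\<forall>(i, j)\<in>set js. comm_value G (h f) (R f) (xs ! i) (xs ! j) = 1)"
    if "f \<in> ?S" for f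
  proof -
    interpret q: flat_cocycle G p k d "h f" by (rule hflat[OF that])
    let ?ps = "map (\<lambda>(i, j). (xs ! i, xs ! j)) js"
    have eq: "map (\<lambda>(x, y). commutator G x y) ?ps = map (\<lambda>(i, j). commutator G (xs ! i) (xs ! j)) js"
      by (simp add: case_prod_unfold comp_def)
    have "set ?ps \<subseteq> carrier G \<times> carrier G" using js(1) xc by auto
    then have "\<exists>r. splits G (h f) Z r \<and> (\<forall>(x, y)\<in>set ?ps. comm_value G (h f) r x y = 1)"
      using js(4,5) unfolding eq[symmetric] by (rule q.splits_normalized)
    then have "\<exists>r. splits G (h f) Z r \<and> (\<forall>(i, j)\<in>set js. comm_value G (h f) r (xs ! i) (xs ! j) = 1)"
      by (force simp: case_prod_unfold)
    then show ?thesis unfolding R_def by (rule someI_ex)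
  qed
  have "card (?S // cohomologous G) \<le> card ((P \<rightarrow>\<^sub>E \<mu>) \<times> (Q \<rightarrow>\<^sub>E \<mu>))"
  proof (rule card_quotient_le[OF equiv_cohomologous, where \<Phi> = "\<lambda>f. (\<Phi> f, \<Psi> f)"])
    show "finite ((P \<rightarrow>\<^sub>E \<mu>) \<times> (Q \<rightarrow>\<^sub>E \<mu>))"
      using Pfin(1) Q(1) \<mu>(1) by (intro finite_cartesian_product finite_PiE) auto
    show "(\<lambda>f. (\<Phi> f, \<Psi> f)) ` ?S \<subseteq> (P \<rightarrow>\<^sub>E \<mu>) \<times> (Q \<rightarrow>\<^sub>E \<mu>)"
    proof (intro image_subsetI SigmaI)
      fix f assume f: "f \<in> ?S"
      interpret f: special_cocycle G p k d f by (rule special_cocycleI[OF f])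
      interpret q: flat_cocycle G p k d "h f" by (rule hflat[OF f])
      show "\<Phi> f \<in> P \<rightarrow>\<^sub>E \<mu>"
        using Pfin(2) f.central_ratio_root by (auto simp: \<Phi>_def \<mu>_def)
      show "\<Psi> f \<in> Q \<rightarrow>\<^sub>E \<mu>"
        using xc R[OF f] q.comm_value_root by (auto simp: \<Psi>_def \<mu>_def Q_def)
    qed
    fix f f' assume f: "f \<in> ?S" "f' \<in> ?S" and "(\<Phi> f, \<Psi> f) = (\<Phi> f', \<Psi> f')"
    then have eq: "\<Phi> f = \<Phi> f'" "\<Psi> f = \<Psi> f'" by auto
    interpret q: flat_cocycle G p k d "h f" by (rule hflat[OF f(1)])
    interpret q': flat_cocycle G p k d "h f'" by (rule hflat[OF f(2)])
    interpret g: flat_cocycle G p k d "\<lambda>x y. f x y / f' x y" by (rule flat[OF f eq(1)])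
    \<comment> \<open>Equal tables \<open>\<Phi>\<close> select the same reference cocycle, which
      cancels from the quotient of \<open>h f\<close> and \<open>h f'\<close>.\<close>
    have quot: "splits G (\<lambda>x y. f x y / f' x y) A r \<longleftrightarrow> splits G (\<lambda>x y. h f x y / h f' x y) A r"
      if "A \<subseteq> carrier G" for A r
    proof -
      have "h f x y / h f' x y = f x y / f' x y" if "x \<in> carrier G" "y \<in> carrier G" for x y
        using F(1)[OF f(1)] that eq(1) by (simp add: h_def schur_cocycles_def)
      then show ?thesis using that unfolding splits_def by (metis subsetD)
    qed
    interpret g': flat_cocycle G p k d "\<lambda>x y. h f x y / h f' x y"
    proof -
      have "h f \<in> ?S" "h f' \<in> ?S" using q.cocycle q'.cocycle by auto
      interpret s: special_cocycle G p k d "\<lambda>x y. h f x y / h f' x y"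
        by (rule special_cocycleI[OF schur_cocycles_divide[OF q.cocycle q'.cocycle]])
      show "flat_cocycle G p k d (\<lambda>x y. h f x y / h f' x y)"
        by unfold_locales (simp add: central_ratio_divide q.flat q'.flat)
    qed
    have "\<exists>g. splits G (\<lambda>x y. h f x y / h f' x y) (carrier G) g"
    proof (rule g'.splits_carrier[OF splits_divide[OF conjunct1[OF R[OF f(1)]] conjunct1[OF R[OF f(2)]]] xs(2,3)])
      fix i j assume ij: "i < j" "j < length xs"
      \<comment> \<open>On \<open>js\<close> both values are 1 by normalisation; on the other pairs
        they agree since the tables \<open>\<Psi>\<close> do.\<close>
      have "comm_value G (h f) (R f) (xs ! i) (xs ! j) = comm_value G (h f') (R f') (xs ! i) (xs ! j)"
      proof (cases "(i, j) \<in> set js")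
        case True
        then show ?thesis using R[OF f(1)] R[OF f(2)] by fastforce
      next
        case False
        then have "(i, j) \<in> Q" using ij xs(1) by (simp add: Q_def)
        then show ?thesis using fun_cong[OF eq(2), of "(i, j)"] by (simp add: \<Psi>_def)
      qed
      moreover have "comm_value G (h f') (R f') (xs ! i) (xs ! j) \<noteq> 0"
        using linear_charD(1)[OF q'.comm_value_linear[OF conjunct1[OF R[OF f(2)]]]] xc ij xs(1) by auto
      ultimately show "comm_value G (\<lambda>x y. h f x y / h f' x y) (\<lambda>x. R f x / R f' x) (xs ! i) (xs ! j) = 1"
        by (simp add: comm_value_divide)
    qed
    then show "(f, f') \<in> cohomologous G" using quot cohomologousI[OF f] by blast
  qed
  also have "\<dots> = p ^ (card P + card Q)"
    using Pfin(1) Q(1) \<mu>(2) by (simp add: card_cartesian_product card_PiE power_add)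
  finally show ?thesis using that[OF P(2) Q(2)] by (simp add: schur_multiplier_order_def)
qed

end

section \<open>From the hypotheses on generator numbers to the bound on the multiplier\<close>

lemma special_p_group_imp_special_group:
  fixes G :: "('a, 'b) monoid_scheme"
  assumes "special_p_group G p" "order G = p ^ n"
    and "min_gens G (carrier G) = d" "min_gens G (derived G (carrier G)) = k"
  shows "special_group G p k d" "n = d + k"
proof -
  interpret group G using assms(1) by (simp add: special_p_group_def)
  have p: "Factorial_Ring.prime p" and fin: "finite (carrier G)"
    and Z: "group_center G = derived G (carrier G)" and e: "elementary_abelian G (group_center G) p"
    using assms(1) unfolding special_p_group_def by blast+
  have "card (group_center G) dvd p ^ n"
    using lagrange[OF derived_is_subgroup[of "carrier G"]] assms(2) unfolding Z by (metis dvd_triv_right order_refl)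
  then obtain a where a: "card (group_center G) = p ^ a" "a \<le> n"
    using divides_primepow_nat[OF p] by auto
  \<comment> \<open>The exponents are first taken from the orders; the generator numbers computed
    for such a group then identify \<open>a\<close> with \<open>k\<close> and \<open>n - a\<close>
    with \<open>d\<close>.\<close>
  interpret special_group G p a "n - a"
    using fin p Z e a assms(2) by unfold_locales (auto simp: elementary_abelian_def order_def)
  have "a = k" "n - a = d" using min_gens_center min_gens_carrier assms(3,4) Z by simp_all
  then show "special_group G p k d" "n = d + k" using special_group_axioms a(2) by auto
qed

theorem theorem3p8:
  fixes G :: "('a, 'b) monoid_scheme" and p n d k :: nat
  assumes "special_p_group G p"
    and "order G = p ^ n"
    and "min_gens G (carrier G) = d"
    and "min_gens G (derived G (carrier G)) = k"
    and "k > 2"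
    and "d > k + 1"
  shows "real (schur_multiplier_order G) \<le>
     real p powr ((1/2) * (real d - 1) * (real n + real k)
                  - (\<Sum>i = 2..k+1. (real d - real i)) - (real k - 2))"
proof -
  interpret special_group G p k d by (rule special_p_group_imp_special_group(1)[OF assms(1-4)])
  have n: "n = d + k" by (rule special_p_group_imp_special_group(2)[OF assms(1-4)])
  obtain a q where aq: "2 * a \<le> k * (k + 1) + 4" "2 * (q + k) = d * (d - 1)"
    "schur_multiplier_order G \<le> p ^ (a + q)"
    using card_schur_multiplier_le assms(5,6) by auto
  \<comment> \<open>Doubled to avoid fractions, with the upper limit freed from \<open>k\<close> for
    the induction.\<close>
  have sum: "2 * (\<Sum>i = 2..m+1. (real d - real i)) = 2 * real m * real d - real m * (real m + 3)" for m
    by (induction m) (auto simp: algebra_simps)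
  define \<sigma> where "\<sigma> = (\<Sum>i = 2..k+1. (real d - real i))"
  have \<sigma>: "2 * \<sigma> = 2 * (real k * real d) - (real k * real k + 3 * real k)"
    using sum[of k] unfolding \<sigma>_def [symmetric] by (simp add: algebra_simps)
  have "real (2 * a) \<le> real (k * (k + 1) + 4)" using aq(1) by (simp only: of_nat_le_iff)
  then have a: "2 * real a \<le> real k * real k + real k + 4" by (simp add: algebra_simps)
  have "real (2 * (q + k)) = real d * real (d - 1)" unfolding aq(2) by (rule of_nat_mult)
  then have q: "2 * real q + 2 * real k = real d * real d - real d"
    using assms(6) by (simp add: of_nat_diff algebra_simps)
  have "2 * ((1/2) * (real d - 1) * (real n + real k)) = real d * real d + 2 * (real k * real d) - real d - 2 * real k"
    by (simp add: n field_simps)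
  \<comment> \<open>At the largest \<open>a\<close> allowed both sides coincide: the exponent equals
    d(d-1)/2 - k + k(k+1)/2 + 2.\<close>
  then have "real (a + q) \<le> (1/2) * (real d - 1) * (real n + real k) - \<sigma> - (real k - 2)"
    using a q \<sigma> unfolding of_nat_add by linarith
  moreover have "real (schur_multiplier_order G) \<le> real p powr real (a + q)"
  proof -
    have "real (schur_multiplier_order G) \<le> real (p ^ (a + q))" using aq(3) by (simp only: of_nat_le_iff)
    also have "\<dots> = real p powr real (a + q)"
      unfolding of_nat_power using prime_gt_0_nat[OF prime_p] by (intro powr_realpow[symmetric]) simp
    finally show ?thesis .
  qed
  moreover have "real p \<ge> 1" using prime_gt_0_nat[OF prime_p] by simp
  ultimately show ?thesis unfolding \<sigma>_def by (meson order_trans powr_mono)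
qed

end
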